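(* Let $G=(V,E,F)$ be a cellular decomposition of a topological torus $S$, all of whose faces have at least $3$ edges and which is essentially 3-connected, and let $c:E\to\mathbb{R}_{>0}$ be positive edge weights. Then the minimal Dirichlet energy is given by $$k_c:=\min\mathcal{D}_c=\sqrt{\frac{\det_0(\tilde d^T C\tilde d)}{\det_0(d^T C d)}}.$$
   Context: Setting. $S$ is an oriented topological torus and $G=(V,E,F)$ is a finite cellular decomposition of $S$ (every open face is an open disk); multiple edges and loops are allowed, but a loop must be non-contractible in $S$. $\tilde G=(\tilde V,\tilde E,\tilde F)$ is the lift of $G$ to the universal cover. $G$ is essentially 3-connected if the 1-skeleton graph of $\tilde G$ is 3-connected (removing at most two vertices leaves it connected). $\gamma_1,\gamma_2$ are generators of $\pi_1(S)$, acting on $\tilde G$ by deck transformations, ordered so that $(\gamma_1,\gamma_2)$ is positively oriented (intersection number $+1$). Edge weights are symmetric: $c_{ij}=c_{ji}$. Energy. $\mathbb{H}\subset\mathbb{C}$ is the upper half plane. For $\tau\in\mathbb{H}$, $S_\tau$ is the unit-area quotient of $\mathbb{C}$ by the translations $z\mapsto z+\frac{1}{\sqrt{\mathrm{Im}\,\tau}}$ (for $\gamma_1$) and $z\mapsto z+\frac{\tau}{\sqrt{\mathrm{Im}\,\tau}}$ (for $\gamma_2$). A straight-line map $h:(V,E)\to S_\tau$ homotopic to the inclusion of the 1-skeleton is given by its lift $\tilde h:\tilde V\to\mathbb{C}$ (edges mapped to straight segments) satisfying $\tilde h\circ\gamma_1=\tilde h+\frac{1}{\sqrt{\mathrm{Im}\,\tau}}$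 and $\tilde h\circ\gamma_2=\tilde h+\frac{\tau}{\sqrt{\mathrm{Im}\,\tau}}$. Its Dirichlet energy is $D_c(h)=\frac12\sum_{ij\in E}c_{ij}|\tilde h_{\tilde j}-\tilde h_{\tilde i}|^2$, where $\tilde i\tilde j$ is any lift of $ij$. $\mathcal{D}_c$ is the function $(\tau,h)\mapsto D_c(h)$ on all pairs consisting of $\tau\in\mathbb{H}$ and such a map $h$ to $S_\tau$. Matrices. Fix an arbitrary orientation of every edge $e$, with head $e_+$ and tail $e_-$. The $E\times V$ incidence matrix $d$ is given by $(df)(e)=f(e_+)-f(e_-)$ for $f\in\mathbb{R}^V$. $C$ is the $E\times E$ diagonal matrix of the edge weights. A discrete 1-form is a function $\omega$ on oriented edges with $\omega_{ij}=-\omega_{ji}$ (via the fixed orientation, a vector in $\mathbb{R}^E$); it is closed if its sum around the boundary of every oriented face is zero; its periods are its sums $\sum_{\gamma_1}\omega,\sum_{\gamma_2}\omega$ along edge paths homotopic to $\gamma_1,\gamma_2$. $\tilde d$ is the $E\times(V+2)$ matrix whose first $|V|$ columns are those of $d$ and whose last two columns are closed 1-forms $m_1,m_2$ (arbitrary ones) with $\left(\sum_{\gamma_1}m_1,\sum_{\gamma_2}m_1\right)=(1,0)$ and $\left(\sum_{\gamma_1}m_2,\sum_{\gamma_2}m_2\right)=(0,1)$. Fix an arbitrary vertex $o\in V$; $\det_0$ denotes the determinant of the matrix obtained by deleting the row and column corresponding to $o$ (the determinant of an empty matrix is $1$). *)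

theory Defs
  imports
    "HOL-Analysis.Analysis"
    "Graph_Theory.Digraph_Component"
    "Jordan_Normal_Form.Determinant"
begin

section \<open>Oriented tori\<close>

text \<open>
  An oriented topological torus is a set \<open>S\<close> with a homeomorphism \<open>\<theta>\<close> from the product of two
  unit circles onto \<open>S\<close>, the orientation of \<open>S\<close> being the one transported by \<open>\<theta>\<close>.  Both
  orientations of a given torus occur, since \<open>\<theta>\<close> may be precomposed with a reflection.
\<close>

definition oriented_torus ::
    "'a::topological_space set \<Rightarrow> (complex \<times> complex \<Rightarrow> 'a) \<Rightarrow> bool" where
  "oriented_torus S \<theta> \<longleftrightarrow>
     (\<exists>\<theta>'. homeomorphism (sphere (0::complex) 1 \<times> sphere (0::complex) 1) S \<theta> \<theta>')"

definition univ_cover :: "(complex \<times> complex \<Rightarrow> 'a) \<Rightarrow> complex \<Rightarrow> 'a" where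
  "univ_cover \<theta> z = \<theta> (cis (2 * pi * Re z), cis (2 * pi * Im z))"

text \<open>
  The deck transformations of \<^term>\<open>univ_cover \<theta>\<close> are the translations \<open>z \<mapsto> z + g\<close> with \<open>g\<close> a Gaussian
  integer; such a \<open>g\<close> stands for an element of the (abelian) fundamental group of \<open>S\<close>, both as the
  deck transformation \<open>z \<mapsto> z + g\<close> and as the class of the loop \<open>deck_loop \<theta> g\<close>.  In
  these coordinates the algebraic intersection number of two classes is the determinant of the
  pair.
\<close>

definition deck_group :: "complex set" where
  "deck_group = {g. Re g \<in> \<int> \<and> Im g \<in> \<int>}"

definition deck_loop :: "(complex \<times> complex \<Rightarrow> 'a) \<Rightarrow> complex \<Rightarrow> real \<Rightarrow> 'a" where
  "deck_loop \<theta> g = univ_cover \<theta> \<circ> linepath 0 g"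

definition intersection_number :: "complex \<Rightarrow> complex \<Rightarrow> real" where
  "intersection_number g1 g2 = Re g1 * Im g2 - Im g1 * Re g2"

definition positive_generators :: "complex \<Rightarrow> complex \<Rightarrow> bool" where
  "positive_generators g1 g2 \<longleftrightarrow>
     g1 \<in> deck_group \<and> g2 \<in> deck_group \<and>
     (\<forall>g\<in>deck_group. \<exists>a b :: int. g = of_int a * g1 + of_int b * g2) \<and>
     intersection_number g1 g2 = 1"

section \<open>Cellular decompositions\<close>

text \<open>
  The cells of each dimension are numbered.  Every edge has a parametrization by \<open>[0,1]\<close>, whose
  direction is also the fixed orientation of the edge, and every face has a characteristic map on
  the closed unit disk.  An oriented edge is a pair of an edge number and a flag, the flag \<open>False\<close>
  meaning reversal.  The list \<open>face_boundary K f\<close> is the cyclic sequence of oriented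
  edges around the face \<open>f\<close>; an edge that has \<open>f\<close> on both sides occurs twice in it.
\<close>

type_synonym oriented_edge = "nat \<times> bool"

record 'a cells =
  num_verts :: nat
  num_edges :: nat
  num_faces :: nat
  vertex_point :: "nat \<Rightarrow> 'a"
  edge_path :: "nat \<Rightarrow> real \<Rightarrow> 'a"
  face_map :: "nat \<Rightarrow> complex \<Rightarrow> 'a"
  face_boundary :: "nat \<Rightarrow> oriented_edge list"

definition vertex_set :: "'a cells \<Rightarrow> 'a set" where
  "vertex_set K = vertex_point K ` {..<num_verts K}"

definition open_edge :: "'a cells \<Rightarrow> nat \<Rightarrow> 'a set" where
  "open_edge K e = edge_path K e ` {0<..<1}"

definition open_face :: "'a cells \<Rightarrow> nat \<Rightarrow> 'a set" where
  "open_face K f = face_map K f ` ball 0 1"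

definition oriented_edge_path ::
    "'a::topological_space cells \<Rightarrow> oriented_edge \<Rightarrow> real \<Rightarrow> 'a" where
  "oriented_edge_path K a =
     (if snd a then edge_path K (fst a) else reversepath (edge_path K (fst a)))"

definition cellular_decomposition :: "'a::topological_space set \<Rightarrow> 'a cells \<Rightarrow> bool" where
  "cellular_decomposition S K \<longleftrightarrow>
     \<comment> \<open>the open cells partition \<open>S\<close>\<close>
     inj_on (vertex_point K) {..<num_verts K} \<and>
     disjoint_family_on (open_edge K) {..<num_edges K} \<and>
     disjoint_family_on (open_face K) {..<num_faces K} \<and>
     (\<forall>e<num_edges K. vertex_set K \<inter> open_edge K e = {}) \<and>
     (\<forall>f<num_faces K. vertex_set K \<inter> open_face K f = {}) \<and>
     (\<forall>e<num_edges K. \<forall>f<num_faces K. open_edge K e \<inter> open_face K f = {}) \<and>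
     S = vertex_set K \<union> (\<Union>e<num_edges K. open_edge K e) \<union> (\<Union>f<num_faces K. open_face K f) \<and>
     \<comment> \<open>edges are open arcs with end points among the vertices\<close>
     (\<forall>e<num_edges K.
        path (edge_path K e) \<and>
        pathstart (edge_path K e) \<in> vertex_set K \<and> pathfinish (edge_path K e) \<in> vertex_set K \<and>
        (\<exists>q. homeomorphism {0<..<1} (open_edge K e) (edge_path K e) q)) \<and>
     \<comment> \<open>faces are open disks, attached along a closed walk of edges\<close>
     (\<forall>f<num_faces K.
        continuous_on (cball 0 1) (face_map K f) \<and>
        (\<exists>q. homeomorphism (ball 0 1) (open_face K f) (face_map K f) q) \<and>
        face_boundary K f \<noteq> [] \<and>
        (\<forall>j<length (face_boundary K f).
           fst (face_boundary K f ! j) < num_edges K \<and>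
           (\<forall>t\<in>{0..1}.
              face_map K f (cis (2 * pi * (real j + t) / real (length (face_boundary K f)))) =
              oriented_edge_path K (face_boundary K f ! j) t))) \<and>
     \<comment> \<open>loops are non-contractible\<close>
     (\<forall>e<num_edges K.
        pathfinish (edge_path K e) = pathstart (edge_path K e) \<longrightarrow>
        \<not> (\<exists>x. homotopic_loops S (edge_path K e) (\<lambda>_. x)))"

section \<open>The lift to the universal cover\<close>

definition lifted_verts :: "(complex \<times> complex \<Rightarrow> 'a) \<Rightarrow> 'a cells \<Rightarrow> complex set" where
  "lifted_verts \<theta> K = {z. univ_cover \<theta> z \<in> vertex_set K}"

definition lifts_edge ::
    "(complex \<times> complex \<Rightarrow> 'a) \<Rightarrow> 'a cells \<Rightarrow> nat \<Rightarrow> complex \<Rightarrow> complex \<Rightarrow> bool" where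
  "lifts_edge \<theta> K e z w \<longleftrightarrow>
     (\<exists>q. path q \<and> pathstart q = z \<and> pathfinish q = w \<and>
        (\<forall>t\<in>{0..1}. univ_cover \<theta> (q t) = edge_path K e t))"

text \<open>An edge of the lift is identified by its tail, the edge below it, and its head.\<close>

definition lifted_graph ::
    "(complex \<times> complex \<Rightarrow> 'a) \<Rightarrow> 'a cells \<Rightarrow> (complex, complex \<times> nat \<times> complex) pre_digraph" where
  "lifted_graph \<theta> K =
     \<lparr> verts = lifted_verts \<theta> K,
       arcs = {(z, e, w) | z e w. e < num_edges K \<and> lifts_edge \<theta> K e z w},
       tail = fst,
       head = snd \<circ> snd \<rparr>"

definition essentially_3_connected :: "(complex \<times> complex \<Rightarrow> 'a) \<Rightarrow> 'a cells \<Rightarrow> bool" where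
  "essentially_3_connected \<theta> K \<longleftrightarrow>
     (\<forall>X \<subseteq> verts (lifted_graph \<theta> K). finite X \<and> card X \<le> 2 \<longrightarrow>
        Digraph_Component.connected
          (induce_subgraph (lifted_graph \<theta> K) (verts (lifted_graph \<theta> K) - X)))"

section \<open>Discrete 1-forms\<close>

text \<open>
  A 1-form is given by its values on the edges in their fixed orientation and extended
  antisymmetrically.
\<close>

definition form_on :: "(nat \<Rightarrow> real) \<Rightarrow> oriented_edge \<Rightarrow> real" where
  "form_on \<omega> a = (if snd a then \<omega> (fst a) else - \<omega> (fst a))"

definition closed_form :: "'a cells \<Rightarrow> (nat \<Rightarrow> real) \<Rightarrow> bool" where
  "closed_form K \<omega> \<longleftrightarrow> (\<forall>f<num_faces K. (\<Sum>a\<leftarrow>face_boundary K f. form_on \<omega> a) = 0)"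

definition closed_edge_walk :: "'a::topological_space cells \<Rightarrow> oriented_edge list \<Rightarrow> bool" where
  "closed_edge_walk K as \<longleftrightarrow>
     as \<noteq> [] \<and> (\<forall>a\<in>set as. fst a < num_edges K) \<and>
     successively
       (\<lambda>a b. pathfinish (oriented_edge_path K a) = pathstart (oriented_edge_path K b)) as \<and>
     pathfinish (oriented_edge_path K (last as)) = pathstart (oriented_edge_path K (hd as))"

fun walk_path :: "'a::topological_space cells \<Rightarrow> oriented_edge list \<Rightarrow> real \<Rightarrow> 'a" where
  "walk_path K [] = undefined"
| "walk_path K [a] = oriented_edge_path K a"
| "walk_path K (a # b # as) = oriented_edge_path K a +++ walk_path K (b # as)"

text \<open>
  The period over \<open>g\<close> is the common value of the sums along all closed edge walks freely homotopic
  to \<open>g\<close> (free and based homotopy classes agree, the fundamental group being abelian).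
\<close>

definition has_period ::
    "'a::topological_space set \<Rightarrow> (complex \<times> complex \<Rightarrow> 'a) \<Rightarrow> 'a cells \<Rightarrow>
     (nat \<Rightarrow> real) \<Rightarrow> complex \<Rightarrow> real \<Rightarrow> bool" where
  "has_period S \<theta> K \<omega> g x \<longleftrightarrow>
     (\<forall>as. closed_edge_walk K as \<and> homotopic_loops S (walk_path K as) (deck_loop \<theta> g) \<longrightarrow>
        (\<Sum>a\<leftarrow>as. form_on \<omega> a) = x)"

section \<open>Dirichlet energy\<close>

text \<open>
  \<open>straight_line_map \<theta> K g1 g2 \<tau> h\<close>: the restriction of \<open>h\<close> to the lifted vertices is the lift of a
  straight-line map to the flat torus with parameter \<open>\<tau>\<close>, homotopic to the inclusion.  The values of
  \<open>h\<close> elsewhere are irrelevant.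
\<close>

definition straight_line_map ::
    "(complex \<times> complex \<Rightarrow> 'a) \<Rightarrow> 'a cells \<Rightarrow> complex \<Rightarrow> complex \<Rightarrow>
     complex \<Rightarrow> (complex \<Rightarrow> complex) \<Rightarrow> bool" where
  "straight_line_map \<theta> K g1 g2 \<tau> h \<longleftrightarrow>
     (\<forall>z\<in>lifted_verts \<theta> K.
        h (z + g1) = h z + 1 / of_real (sqrt (Im \<tau>)) \<and>
        h (z + g2) = h z + \<tau> / of_real (sqrt (Im \<tau>)))"

text \<open>The summand does not depend on the lift chosen below, by equivariance of \<open>h\<close>.\<close>

definition some_lift :: "(complex \<times> complex \<Rightarrow> 'a) \<Rightarrow> 'a cells \<Rightarrow> nat \<Rightarrow> complex \<times> complex" where
  "some_lift \<theta> K e = (SOME (z, w). lifts_edge \<theta> K e z w)"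

definition dirichlet_energy ::
    "(complex \<times> complex \<Rightarrow> 'a) \<Rightarrow> 'a cells \<Rightarrow> (nat \<Rightarrow> real) \<Rightarrow> (complex \<Rightarrow> complex) \<Rightarrow> real" where
  "dirichlet_energy \<theta> K c h =
     1 / 2 * (\<Sum>e<num_edges K. c e *
        (cmod (h (snd (some_lift \<theta> K e)) - h (fst (some_lift \<theta> K e))))\<^sup>2)"

section \<open>Matrices\<close>

text \<open>For a loop both indicators agree, so its row vanishes.\<close>

definition incidence_entry :: "'a::topological_space cells \<Rightarrow> nat \<Rightarrow> nat \<Rightarrow> real" where
  "incidence_entry K e i =
     of_bool (pathfinish (edge_path K e) = vertex_point K i) -
     of_bool (pathstart (edge_path K e) = vertex_point K i)"

definition d_mat :: "'a::topological_space cells \<Rightarrow> real mat" where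
  "d_mat K = Matrix.mat (num_edges K) (num_verts K) (\<lambda>(e, i). incidence_entry K e i)"

definition d_tilde_mat ::
    "'a::topological_space cells \<Rightarrow> (nat \<Rightarrow> real) \<Rightarrow> (nat \<Rightarrow> real) \<Rightarrow> real mat" where
  "d_tilde_mat K m1 m2 =
     Matrix.mat (num_edges K) (num_verts K + 2)
       (\<lambda>(e, i). if i < num_verts K then incidence_entry K e i
                 else if i = num_verts K then m1 e else m2 e)"

definition weight_mat :: "'a cells \<Rightarrow> (nat \<Rightarrow> real) \<Rightarrow> real mat" where
  "weight_mat K c = mat_diag (num_edges K) c"

definition det0 :: "nat \<Rightarrow> real mat \<Rightarrow> real" where
  "det0 v A = Determinant.det (mat_delete A v v)"

end

theory Submission
  imports Defs
begin

text \<open>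
  Both sides of the formula are invariants of one positive definite quadratic form in two variables.
  For real \<open>a\<close>, \<open>b\<close> let \<open>q(a, b)\<close> be the least value of \<open>\<Sum>\<^sub>e c\<^sub>e \<omega>(e)\<^sup>2\<close> over the closed 1-forms
  \<open>\<omega> = d f + a m\<^sub>1 + b m\<^sub>2\<close> with periods \<open>(a, b)\<close>.  Replacing \<open>m\<^sub>1\<close>, \<open>m\<^sub>2\<close> by their harmonic
  representatives \<open>\<mu>\<^sub>1\<close>, \<open>\<mu>\<^sub>2\<close>, which are orthogonal to all gradients, gives
  \<open>q(a, b) = p a\<^sup>2 + 2 r a b + s b\<^sup>2\<close>, where \<open>p\<close>, \<open>r\<close>, \<open>s\<close> are the inner products of \<open>\<mu>\<^sub>1\<close>, \<open>\<mu>\<^sub>2\<close>.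

  Determinants.  Passing from \<open>m\<^sub>k\<close> to \<open>\<mu>\<^sub>k\<close> is a unipotent column operation on the extended
  incidence matrix.  It makes the Gram matrix block diagonal, with one block the reduced Laplacian
  and the other the matrix of \<open>q\<close>; hence the ratio of determinants is \<open>p s - r\<^sup>2\<close>
  (lemma \<open>determinant_ratio\<close>).

  Energy.  The forms \<open>m\<^sub>k\<close> have single-valued potentials \<open>M\<^sub>k\<close> on the lifted vertices
  (lemma \<open>potential_exists\<close>): an edge walk of the lift from \<open>z\<close> to \<open>z + g\<close> projects to a closed
  walk freely homotopic to \<open>g\<close>, by a straight-line homotopy in the universal cover.  Subtracting
  \<open>M\<^sub>1 / \<surd>(Im \<tau>) + \<tau> M\<^sub>2 / \<surd>(Im \<tau>)\<close> from a straight-line map leaves a function invariant under deck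
  transformations, that is, a function on the vertices of \<open>G\<close>.  By orthogonality the energy is
  therefore at least \<open>(p + 2 r Re \<tau> + s \<bar>\<tau>\<bar>\<^sup>2) / (2 Im \<tau>)\<close>, attained by the harmonic map
  (lemmas \<open>dirichlet_energy_lower_bound\<close> and \<open>dirichlet_energy_of_potentials\<close>).

  Minimizing over \<open>\<tau>\<close>, one completes the square in \<open>Re \<tau>\<close> and applies the inequality between
  arithmetic and geometric means in \<open>Im \<tau>\<close>: the minimum is \<open>\<surd>(p s - r\<^sup>2)\<close>, at
  \<open>\<tau> = (- r + \<i> \<surd>(p s - r\<^sup>2)) / s\<close>.  This point lies in the upper half plane because \<open>q\<close> is
  positive definite: a form with a nonzero period does not vanish on every edge.
\<close>

text \<open>The infix dollar sign denotes entries of list-like vectors below, not of finite Cartesian products.\<close>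

unbundle no vec_syntax

section \<open>Weighted Gram matrices\<close>

text \<open>
  The matrix \<open>B\<^sup>T C B\<close> for the matrix \<open>B\<close> with entries \<open>b e i\<close> and diagonal \<open>C\<close>.  Keeping \<open>B\<close> as a
  function lets rows and columns be deleted and adjoined by reindexing.
\<close>

definition weighted_gram :: "nat \<Rightarrow> nat \<Rightarrow> (nat \<Rightarrow> real) \<Rightarrow> (nat \<Rightarrow> nat \<Rightarrow> real) \<Rightarrow> real mat" where
  "weighted_gram m n c b = Matrix.mat n n (\<lambda>(i, j). \<Sum>e<m. c e * b e i * b e j)"

lemma weighted_gram_carrier [simp]: "weighted_gram m n c b \<in> carrier_mat n n"
  by (simp add: weighted_gram_def)

lemma weighted_gram_eq_product:
  "transpose_mat (Matrix.mat m n (\<lambda>(e, i). b e i)) * mat_diag m c * Matrix.mat m n (\<lambda>(e, i). b e i) =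
   weighted_gram m n c b"
proof -
  let ?B = "Matrix.mat m n (\<lambda>(e, i). b e i)"
  have "transpose_mat ?B * mat_diag m c = Matrix.mat n m (\<lambda>(i, e). b e i * c e)"
    by (subst mat_diag_mult_right[of _ n]) (auto intro!: eq_matI)
  then show ?thesis
    by (auto intro!: eq_matI sum.cong
        simp: weighted_gram_def scalar_prod_def lessThan_atLeast0 mult_ac)
qed

lemma mat_delete_weighted_gram:
  "mat_delete (weighted_gram m (Suc n) c b) v v =
   weighted_gram m n c (\<lambda>e i. b e (insert_index v i))"
  by (auto intro!: eq_matI simp: mat_delete_def weighted_gram_def insert_index_def)

lemma weighted_gram_column_operation:
  assumes U: "U \<in> carrier_mat n n"
  shows "weighted_gram m n c (\<lambda>e j. \<Sum>i<n. b e i * U $$ (i, j)) =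
         transpose_mat U * weighted_gram m n c b * U"
proof -
  let ?B = "Matrix.mat m n (\<lambda>(e, i). b e i)"
  let ?C = "mat_diag m c :: real mat"
  have B: "?B \<in> carrier_mat m n" and C: "?C \<in> carrier_mat m m" by auto
  have "Matrix.mat m n (\<lambda>(e, j). \<Sum>i<n. b e i * U $$ (i, j)) = ?B * U"
    using U by (auto intro!: eq_matI sum.cong simp: scalar_prod_def lessThan_atLeast0)
  then have "weighted_gram m n c (\<lambda>e j. \<Sum>i<n. b e i * U $$ (i, j)) =
      transpose_mat (?B * U) * ?C * (?B * U)"
    using weighted_gram_eq_product[of m n "\<lambda>e j. \<Sum>i<n. b e i * U $$ (i, j)" c] by simp
  also have "\<dots> = transpose_mat U * (transpose_mat ?B * ?C * ?B) * U"
  proof -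
    have T: "transpose_mat (?B * U) = transpose_mat U * transpose_mat ?B"
      by (rule transpose_mult[OF B U])
    have tB: "transpose_mat ?B \<in> carrier_mat n m" and tU: "transpose_mat U \<in> carrier_mat n n"
      using U by auto
    have "transpose_mat U * transpose_mat ?B * ?C = transpose_mat U * (transpose_mat ?B * ?C)"
      by (rule assoc_mult_mat[OF tU tB C])
    moreover have "transpose_mat U * (transpose_mat ?B * ?C) * (?B * U) =
        transpose_mat U * (transpose_mat ?B * ?C) * ?B * U"
      by (rule assoc_mult_mat[symmetric, OF mult_carrier_mat[OF tU mult_carrier_mat[OF tB C]] B U])
    moreover have "transpose_mat U * (transpose_mat ?B * ?C) * ?B = transpose_mat U * (transpose_mat ?B * ?C * ?B)"
      by (rule assoc_mult_mat[OF tU mult_carrier_mat[OF tB C] B])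
    ultimately show ?thesis unfolding T by simp
  qed
  finally show ?thesis by (simp only: weighted_gram_eq_product)
qed

lemma det_mat_2_2:
  assumes A: "A \<in> carrier_mat 2 2"
  shows "Determinant.det A = A $$ (0,0) * A $$ (1,1) - A $$ (1,0) * A $$ (0,1)"
proof -
  have "Determinant.det (mat_delete A i 0) = mat_delete A i 0 $$ (0,0)" for i
    using mat_delete_carrier[OF A, of i 0] by (intro det_single) simp
  then show ?thesis
    using A by (subst laplace_expansion_column[OF A, of 0])
      (auto simp: cofactor_def mat_delete_def numeral_2_eq_2)
qed

text \<open>
  Columns \<open>n\<close> and \<open>n + 1\<close> being orthogonal to the earlier ones, the Gram matrix is block diagonal.
\<close>

lemma det_weighted_gram_orthogonal_extension:
  assumes "\<And>i. i < n \<Longrightarrow> (\<Sum>e<m. c e * b e i * b e n) = 0"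
    and "\<And>i. i < n \<Longrightarrow> (\<Sum>e<m. c e * b e i * b e (Suc n)) = 0"
  shows "Determinant.det (weighted_gram m (n + 2) c b) =
    Determinant.det (weighted_gram m n c b) *
    ((\<Sum>e<m. c e * (b e n)\<^sup>2) * (\<Sum>e<m. c e * (b e (Suc n))\<^sup>2) - (\<Sum>e<m. c e * b e n * b e (Suc n))\<^sup>2)"
proof -
  let ?D = "weighted_gram m 2 c (\<lambda>e i. b e (n + i))"
  have zero: "(\<Sum>e<m. c e * b e i * b e j) = 0" if "i < n" "\<not> j < n" "j < Suc (Suc n)" for i j
  proof -
    have "j = n \<or> j = Suc n" using that by auto
    then show ?thesis using assms that by auto
  qed
  have zero': "(\<Sum>e<m. c e * b e j * b e i) = 0" if "i < n" "\<not> j < n" "j < Suc (Suc n)" for i j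
    using zero[OF that] by (simp add: mult_ac)
  have "weighted_gram m (n + 2) c b =
      four_block_mat (weighted_gram m n c b) (0\<^sub>m n 2) (0\<^sub>m 2 n) ?D"
    by (rule eq_matI) (auto simp: weighted_gram_def zero zero')
  then have "Determinant.det (weighted_gram m (n + 2) c b) =
      Determinant.det (weighted_gram m n c b) * Determinant.det ?D"
    by (simp add: det_four_block_mat_lower_left_zero[of _ n _ 2])
  moreover have "Determinant.det ?D = ?D $$ (0,0) * ?D $$ (1,1) - ?D $$ (1,0) * ?D $$ (0,1)"
    by (rule det_mat_2_2) simp
  ultimately show ?thesis
    by (simp add: weighted_gram_def power2_eq_square mult_ac)
qed

text \<open>
  Adding combinations of the first \<open>n\<close> columns to the last two is multiplication by a unipotent
  matrix, so it does not change the determinant; a shift that achieves orthogonality thus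
  computes the Schur complement.
\<close>

lemma det_weighted_gram_extension:
  fixes b :: "nat \<Rightarrow> nat \<Rightarrow> real" and x1 x2 :: "nat \<Rightarrow> real" and n :: nat
  defines "\<mu>1 \<equiv> \<lambda>e. b e n + (\<Sum>i<n. b e i * x1 i)"
    and "\<mu>2 \<equiv> \<lambda>e. b e (Suc n) + (\<Sum>i<n. b e i * x2 i)"
  assumes "\<And>i. i < n \<Longrightarrow> (\<Sum>e<m. c e * b e i * \<mu>1 e) = 0"
    and "\<And>i. i < n \<Longrightarrow> (\<Sum>e<m. c e * b e i * \<mu>2 e) = 0"
  shows "Determinant.det (weighted_gram m (n + 2) c b) =
    Determinant.det (weighted_gram m n c b) *
    ((\<Sum>e<m. c e * (\<mu>1 e)\<^sup>2) * (\<Sum>e<m. c e * (\<mu>2 e)\<^sup>2) - (\<Sum>e<m. c e * \<mu>1 e * \<mu>2 e)\<^sup>2)"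
proof -
  note orth = assms(3,4)
  define U where "U = Matrix.mat (n + 2) (n + 2)
    (\<lambda>(i, j). if i = j then 1 else if i < n \<and> j = n then x1 i
              else if i < n \<and> j = Suc n then x2 i else 0)"
  define b' where "b' = (\<lambda>e j. \<Sum>i<n + 2. b e i * U $$ (i, j))"
  have U: "U \<in> carrier_mat (n + 2) (n + 2)" by (simp add: U_def)
  have "Determinant.det U = prod_list (diag_mat U)"
    by (rule det_upper_triangular[OF _ U]) (auto simp: U_def)
  then have detU: "Determinant.det U = 1"
    unfolding prod_list_diag_prod by (simp add: U_def)
  have old: "b' e j = b e j" if "j < n" for e j
  proof -
    have "b' e j = (\<Sum>i<n + 2. if i = j then b e i else 0)"
      unfolding b'_def using that by (intro sum.cong) (auto simp: U_def)
    then show ?thesis using that by simp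
  qed
  have new: "b' e n = \<mu>1 e" "b' e (Suc n) = \<mu>2 e" for e
    by (simp_all add: b'_def U_def \<mu>1_def \<mu>2_def)
  have "Determinant.det (weighted_gram m (n + 2) c b') =
      Determinant.det (transpose_mat U * weighted_gram m (n + 2) c b * U)"
    unfolding b'_def by (simp only: weighted_gram_column_operation[OF U])
  also have "\<dots> = Determinant.det U * Determinant.det (weighted_gram m (n + 2) c b) * Determinant.det U"
    using U by (simp add: det_mult[of _ "n + 2"] det_transpose)
  finally have "Determinant.det (weighted_gram m (n + 2) c b) = Determinant.det (weighted_gram m (n + 2) c b')"
    by (simp add: detU)
  also have "\<dots> = Determinant.det (weighted_gram m n c b') *
    ((\<Sum>e<m. c e * (\<mu>1 e)\<^sup>2) * (\<Sum>e<m. c e * (\<mu>2 e)\<^sup>2) - (\<Sum>e<m. c e * \<mu>1 e * \<mu>2 e)\<^sup>2)"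
    by (subst det_weighted_gram_orthogonal_extension) (simp_all add: orth old new)
  also have "weighted_gram m n c b' = weighted_gram m n c b"
    by (auto intro!: eq_matI simp: weighted_gram_def old)
  finally show ?thesis .
qed

lemma weighted_gram_mult_vec:
  assumes v: "v \<in> carrier_vec n" and i: "i < n"
  shows "(weighted_gram m n c b *\<^sub>v v) $ i = (\<Sum>e<m. c e * b e i * (\<Sum>j<n. b e j * v $ j))"
proof -
  have "(weighted_gram m n c b *\<^sub>v v) $ i = (\<Sum>j<n. \<Sum>e<m. c e * b e i * (b e j * v $ j))"
    using assms
    by (simp add: weighted_gram_def scalar_prod_def lessThan_atLeast0 sum_distrib_left mult_ac)
  also have "\<dots> = (\<Sum>e<m. \<Sum>j<n. c e * b e i * (b e j * v $ j))"
    by (rule sum.swap)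
  finally show ?thesis by (simp add: sum_distrib_left)
qed

text \<open>
  The quadratic form of a Gram matrix is the weighted sum of squares of the values \<open>B x\<close>, so a kernel
  vector of the Gram matrix is a kernel vector of \<open>B\<close>.
\<close>

lemma det_weighted_gram_nonzero:
  assumes c: "\<And>e. e < m \<Longrightarrow> 0 < c e"
    and inj: "\<And>x. (\<And>e. e < m \<Longrightarrow> (\<Sum>i<n. b e i * x i) = 0) \<Longrightarrow> (\<And>i. i < n \<Longrightarrow> x i = 0)"
  shows "Determinant.det (weighted_gram m n c b) \<noteq> 0"
proof
  assume "Determinant.det (weighted_gram m n c b) = 0"
  then obtain v where v: "v \<in> carrier_vec n" "v \<noteq> 0\<^sub>v n" "weighted_gram m n c b *\<^sub>v v = 0\<^sub>v n"
    using det_0_iff_vec_prod_zero[of "weighted_gram m n c b" n] by auto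
  let ?y = "\<lambda>e. \<Sum>j<n. b e j * v $ j"
  have "(\<Sum>e<m. c e * (?y e)\<^sup>2) = (\<Sum>e<m. \<Sum>i<n. v $ i * (c e * b e i * ?y e))"
  proof (rule sum.cong[OF refl])
    fix e
    have "c e * (?y e)\<^sup>2 = (\<Sum>i<n. b e i * v $ i) * (c e * ?y e)"
      by (simp add: power2_eq_square mult_ac)
    also have "\<dots> = (\<Sum>i<n. v $ i * (c e * b e i * ?y e))"
      by (subst sum_distrib_right) (simp add: mult_ac)
    finally show "c e * (?y e)\<^sup>2 = (\<Sum>i<n. v $ i * (c e * b e i * ?y e))" .
  qed
  also have "\<dots> = (\<Sum>i<n. v $ i * (\<Sum>e<m. c e * b e i * ?y e))"
    by (subst sum.swap) (simp add: sum_distrib_left)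
  also have "\<dots> = (\<Sum>i<n. v $ i * (weighted_gram m n c b *\<^sub>v v) $ i)"
    using v(1) by (simp add: weighted_gram_mult_vec)
  also have "\<dots> = 0" by (simp add: v(3))
  finally have sq: "(\<Sum>e<m. c e * (?y e)\<^sup>2) = 0" .
  have nn: "0 \<le> c e * (?y e)\<^sup>2" if "e \<in> {..<m}" for e
    using c[of e] that by (intro mult_nonneg_nonneg) (auto simp: less_imp_le)
  have "c e * (?y e)\<^sup>2 = 0" if "e < m" for e
    using sum_nonneg_eq_0_iff[OF finite_lessThan nn] sq that by auto
  then have "?y e = 0" if "e < m" for e using c[of e] that by fastforce
  then have "v $ i = 0" if "i < n" for i
    using inj[of "\<lambda>j. v $ j"] that by blast
  with v(1,2) show False by (auto intro: eq_vecI)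
qed

text \<open>
  The normal equations of the weighted least squares problem for \<open>y\<close>: the residual \<open>y + B x\<close> is
  orthogonal to the columns of \<open>B\<close>.  The solution comes from Cramer's rule.
\<close>

lemma weighted_gram_normal_equation:
  assumes "Determinant.det (weighted_gram m n c b) \<noteq> 0"
  obtains x where "\<And>i. i < n \<Longrightarrow> (\<Sum>e<m. c e * b e i * (y e + (\<Sum>j<n. b e j * x j))) = 0"
proof -
  let ?A = "weighted_gram m n c b"
  let ?w = "Matrix.vec n (\<lambda>i. - (\<Sum>e<m. c e * b e i * y e) / Determinant.det ?A)"
  let ?x = "adj_mat ?A *\<^sub>v ?w"
  note adj = adj_mat[OF weighted_gram_carrier]
  have x: "?x \<in> carrier_vec n" using adj(1)[of m n c b] by auto
  have "?A *\<^sub>v ?x = (?A * adj_mat ?A) *\<^sub>v ?w"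
    using adj(1)[of m n c b] by (intro assoc_mult_mat_vec[symmetric, of _ n n _ n]) auto
  also have "\<dots> = Determinant.det ?A \<cdot>\<^sub>v ?w" by (auto simp: adj(2))
  finally have eq: "?A *\<^sub>v ?x = Determinant.det ?A \<cdot>\<^sub>v ?w" .
  have "(\<Sum>e<m. c e * b e i * (y e + (\<Sum>j<n. b e j * ?x $ j))) = 0" if "i < n" for i
  proof -
    have "(\<Sum>e<m. c e * b e i * (y e + (\<Sum>j<n. b e j * ?x $ j))) =
        (\<Sum>e<m. c e * b e i * y e) + (?A *\<^sub>v ?x) $ i"
      by (simp only: weighted_gram_mult_vec[OF x that] distrib_left sum.distrib)
    also have "\<dots> = 0" unfolding eq using assms that by simp
    finally show ?thesis .
  qed
  then show ?thesis by (rule that)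
qed

section \<open>Quadratic forms and flat tori of unit area\<close>

lemma weighted_pythagoras:
  fixes \<phi> \<eta> :: "nat \<Rightarrow> complex"
  assumes "\<And>i. i < n \<Longrightarrow> (\<Sum>e<m. of_real (c e * b e i) * \<eta> e) = 0"
  shows "(\<Sum>e<m. c e * (cmod ((\<Sum>i<n. of_real (b e i) * \<phi> i) + \<eta> e))\<^sup>2) =
    (\<Sum>e<m. c e * (cmod (\<Sum>i<n. of_real (b e i) * \<phi> i))\<^sup>2) + (\<Sum>e<m. c e * (cmod (\<eta> e))\<^sup>2)"
proof -
  let ?\<delta> = "\<lambda>e. \<Sum>i<n. of_real (b e i) * \<phi> i"
  have expand: "(cmod (x + y))\<^sup>2 = (cmod x)\<^sup>2 + (cmod y)\<^sup>2 + 2 * Re (x * cnj y)" for x y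
    unfolding cmod_power2 by (simp add: power2_eq_square algebra_simps)
  have "(\<Sum>e<m. of_real (c e) * (?\<delta> e * cnj (\<eta> e))) =
      (\<Sum>e<m. \<Sum>i<n. \<phi> i * (of_real (c e * b e i) * cnj (\<eta> e)))"
    by (simp add: sum_distrib_left sum_distrib_right mult_ac)
  also have "\<dots> = (\<Sum>i<n. \<phi> i * cnj (\<Sum>e<m. of_real (c e * b e i) * \<eta> e))"
    by (subst sum.swap) (simp add: sum_distrib_left)
  also have "\<dots> = 0"
    by (intro sum.neutral ballI) (simp only: assms lessThan_iff complex_cnj_zero mult_zero_right)
  finally have "Re (\<Sum>e<m. of_real (c e) * (?\<delta> e * cnj (\<eta> e))) = 0" by simp
  then have "(\<Sum>e<m. c e * Re (?\<delta> e * cnj (\<eta> e))) = 0"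
    by (simp only: Re_sum times_complex.sel Re_complex_of_real Im_complex_of_real mult_zero_left diff_zero)
  then have "(\<Sum>e<m. c e * (2 * Re (?\<delta> e * cnj (\<eta> e)))) = 0"
    by (simp only: mult.left_commute[of _ 2] mult_zero_right flip: sum_distrib_left)
  then show ?thesis
    by (simp only: expand distrib_left sum.distrib)
qed

text \<open>
  The right-hand side is the value of the quadratic form of \<open>u\<close>, \<open>v\<close> at the lattice with parameter \<open>\<tau>\<close>,
  normalized to unit area: the real and the imaginary parts of the edge vectors contribute the
  values at the two coordinate rows \<open>(1, Re \<tau>)\<close> and \<open>(0, Im \<tau>)\<close>, divided by \<open>Im \<tau>\<close>.
\<close>

lemma flat_torus_energy:
  assumes "0 < Im \<tau>"
  shows "(\<Sum>e<m. c e * (cmod (1 / of_real (sqrt (Im \<tau>)) * of_real (u e) +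
            \<tau> / of_real (sqrt (Im \<tau>)) * of_real (v e)))\<^sup>2) =
    ((\<Sum>e<m. c e * (u e)\<^sup>2) + 2 * Re \<tau> * (\<Sum>e<m. c e * u e * v e) +
      ((Re \<tau>)\<^sup>2 + (Im \<tau>)\<^sup>2) * (\<Sum>e<m. c e * (v e)\<^sup>2)) / Im \<tau>"
proof -
  have "(cmod (1 / of_real (sqrt (Im \<tau>)) * of_real a + \<tau> / of_real (sqrt (Im \<tau>)) * of_real b))\<^sup>2 =
      (a\<^sup>2 + 2 * Re \<tau> * (a * b) + ((Re \<tau>)\<^sup>2 + (Im \<tau>)\<^sup>2) * b\<^sup>2) / Im \<tau>" for a b
  proof -
    have "1 / of_real (sqrt (Im \<tau>)) * of_real a + \<tau> / of_real (sqrt (Im \<tau>)) * of_real b =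
        (of_real a + \<tau> * of_real b) / of_real (sqrt (Im \<tau>))"
      by (simp add: add_divide_distrib)
    also have "(cmod \<dots>)\<^sup>2 = (cmod (of_real a + \<tau> * of_real b))\<^sup>2 / Im \<tau>"
      using assms by (simp add: norm_divide power_divide)
    also have "(cmod (of_real a + \<tau> * of_real b))\<^sup>2 =
        a\<^sup>2 + 2 * Re \<tau> * (a * b) + ((Re \<tau>)\<^sup>2 + (Im \<tau>)\<^sup>2) * b\<^sup>2"
      unfolding cmod_power2 by (simp add: power2_eq_square algebra_simps)
    finally show ?thesis .
  qed
  then show ?thesis
    by (simp add: sum_divide_distrib sum_distrib_left sum.distrib add_divide_distrib algebra_simps)
qed

text \<open>
  After multiplication by \<open>s y\<close> the difference of the two sides is a sum of two squares; they vanish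
  exactly at the point of lemma \<open>lattice_energy_minimum\<close>.
\<close>

lemma lattice_energy_lower_bound:
  fixes p r s x y :: real
  assumes s: "0 < s" and y: "0 < y" and D: "0 \<le> p * s - r\<^sup>2"
  shows "2 * sqrt (p * s - r\<^sup>2) \<le> (p + 2 * x * r + (x\<^sup>2 + y\<^sup>2) * s) / y"
proof -
  let ?q = "sqrt (p * s - r\<^sup>2)"
  have q: "?q\<^sup>2 = p * s - r\<^sup>2" using D by simp
  have "s * (p + 2 * x * r + (x\<^sup>2 + y\<^sup>2) * s) - s * (2 * ?q * y) = (r + s * x)\<^sup>2 + (?q - s * y)\<^sup>2"
    using q by (simp add: power2_eq_square algebra_simps)
  then have "s * (2 * ?q * y) \<le> s * (p + 2 * x * r + (x\<^sup>2 + y\<^sup>2) * s)"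
    by (smt (verit) zero_le_power2)
  then show ?thesis using s y by (simp add: pos_le_divide_eq)
qed

lemma lattice_energy_minimum:
  fixes p r s :: real
  assumes s: "0 < s" and D: "0 < p * s - r\<^sup>2"
  defines "x \<equiv> - r / s" and "y \<equiv> sqrt (p * s - r\<^sup>2) / s"
  shows "(p + 2 * x * r + (x\<^sup>2 + y\<^sup>2) * s) / y = 2 * sqrt (p * s - r\<^sup>2)"
proof -
  define q where "q = sqrt (p * s - r\<^sup>2)"
  have q: "q\<^sup>2 = p * s - r\<^sup>2" "0 < q" using D by (simp_all add: q_def)
  have y: "y = q / s" by (simp add: y_def q_def)
  have "p + 2 * x * r + (x\<^sup>2 + y\<^sup>2) * s = (p * s - r\<^sup>2 + q\<^sup>2) / s"
    using s unfolding x_def y by (simp add: field_simps power2_eq_square)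
  also have "\<dots> = 2 * q * y" unfolding q(1)[symmetric] y by (simp add: power2_eq_square)
  finally have "(p + 2 * x * r + (x\<^sup>2 + y\<^sup>2) * s) / y = 2 * q" using q(2) s by (simp add: y)
  then show ?thesis by (simp only: q_def)
qed

section \<open>Lifting paths and edge walks\<close>

lemma cis_2pi_eq_iff: "cis (2 * pi * a) = cis (2 * pi * b) \<longleftrightarrow> a - b \<in> \<int>"
proof
  assume eq: "cis (2 * pi * a) = cis (2 * pi * b)"
  have "cis (2 * pi * (a - b)) = cis (2 * pi * a) / cis (2 * pi * b)"
    by (simp add: cis_divide right_diff_distrib)
  also have "\<dots> = 1" by (simp add: eq)
  finally have "cos (2 * pi * (a - b)) = 1" by (simp add: complex_eq_iff)
  then obtain n :: int where "2 * pi * (a - b) = of_int n * 2 * pi"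
    by (auto simp: cos_one_2pi_int)
  then have "a - b = of_int n" by simp
  then show "a - b \<in> \<int>" by simp
next
  assume "a - b \<in> \<int>"
  then have "cis (2 * pi * (a - b)) = 1" by (rule cis_multiple_2pi)
  moreover have "cis (2 * pi * a) = cis (2 * pi * b) * cis (2 * pi * (a - b))"
    by (simp add: cis_mult algebra_simps)
  ultimately show "cis (2 * pi * a) = cis (2 * pi * b)" by simp
qed

text \<open>
  A path avoiding the origin has a continuous logarithm; on the unit circle its real part vanishes.
\<close>

lemma circle_path_lift:
  assumes f: "continuous_on {0..1::real} f" and circle: "\<And>t. t \<in> {0..1} \<Longrightarrow> f t \<in> sphere (0::complex) 1"
  obtains a where "continuous_on {0..1} a" "\<And>t. t \<in> {0..1} \<Longrightarrow> f t = cis (2 * pi * a t)"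
proof -
  have "contractible {0..1::real}" by (simp add: convex_imp_contractible)
  moreover have "f t \<noteq> 0" if "t \<in> {0..1}" for t using circle[OF that] by auto
  ultimately obtain l where l: "continuous_on {0..1} l" "\<And>t. t \<in> {0..1} \<Longrightarrow> f t = exp (l t)"
    using continuous_logarithm_on_contractible[OF f] by blast
  show ?thesis
  proof
    show "continuous_on {0..1} (\<lambda>t. Im (l t) / (2 * pi))"
      using l(1) by (intro continuous_intros) auto
    fix t :: real assume t: "t \<in> {0..1}"
    have "exp (Re (l t)) = 1" using circle[OF t] l(2)[OF t] by simp
    then have "f t = cis (Im (l t))" using l(2)[OF t] by (simp add: exp_eq_polar)
    then show "f t = cis (2 * pi * (Im (l t) / (2 * pi)))" by simp
  qed
qed

text \<open>
  Every edge is lifted in its own direction, so a reversed edge swaps the end points of the lift.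
\<close>

fun lifts_oriented_edge ::
    "(complex \<times> complex \<Rightarrow> 'a) \<Rightarrow> 'a cells \<Rightarrow> oriented_edge \<Rightarrow> complex \<Rightarrow> complex \<Rightarrow> bool" where
  "lifts_oriented_edge \<theta> K (e, b) z w \<longleftrightarrow>
     e < num_edges K \<and> (if b then lifts_edge \<theta> K e z w else lifts_edge \<theta> K e w z)"

fun lifted_walk ::
    "(complex \<times> complex \<Rightarrow> 'a) \<Rightarrow> 'a cells \<Rightarrow> complex \<Rightarrow> oriented_edge list \<Rightarrow> complex \<Rightarrow> bool" where
  "lifted_walk \<theta> K z [] w \<longleftrightarrow> z \<in> lifted_verts \<theta> K \<and> z = w"
| "lifted_walk \<theta> K z (a # as) w \<longleftrightarrow> (\<exists>y. lifts_oriented_edge \<theta> K a z y \<and> lifted_walk \<theta> K y as w)"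

lemma lifted_walk_append:
  "lifted_walk \<theta> K z as y \<Longrightarrow> lifted_walk \<theta> K y bs w \<Longrightarrow> lifted_walk \<theta> K z (as @ bs) w"
  by (induction as arbitrary: z) auto

lemma lifts_oriented_edge_path:
  assumes "lifts_oriented_edge \<theta> K a z w"
  obtains q where "path q" "pathstart q = z" "pathfinish q = w"
    "\<And>t. t \<in> {0..1} \<Longrightarrow> univ_cover \<theta> (q t) = oriented_edge_path K a t"
proof (cases "snd a")
  case True
  then have "lifts_edge \<theta> K (fst a) z w" using assms by (cases a) auto
  then show ?thesis using that True
    by (auto simp: lifts_edge_def oriented_edge_path_def)
next
  case False
  then have "lifts_edge \<theta> K (fst a) w z" using assms by (cases a) auto
  then obtain q where q: "path q" "pathstart q = w" "pathfinish q = z"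
    "\<forall>t\<in>{0..1}. univ_cover \<theta> (q t) = edge_path K (fst a) t"
    by (auto simp: lifts_edge_def)
  have "univ_cover \<theta> (reversepath q t) = oriented_edge_path K a t" if "t \<in> {0..1}" for t
    using q(4) that False by (simp add: oriented_edge_path_def reversepath_def)
  with q(1-3) show ?thesis by (intro that[of "reversepath q"]) auto
qed

lemma lifted_walk_path:
  assumes "lifted_walk \<theta> K z as w" "as \<noteq> []"
  shows "\<exists>q. path q \<and> pathstart q = z \<and> pathfinish q = w \<and>
    (\<forall>t\<in>{0..1}. univ_cover \<theta> (q t) = walk_path K as t)"
  using assms
proof (induction K as arbitrary: z rule: walk_path.induct)
  case (1 K)
  then show ?case by simp
next
  case (2 K a)
  then have "lifts_oriented_edge \<theta> K a z w" by auto
  then show ?case by (rule lifts_oriented_edge_path) auto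
next
  case (3 K a b as)
  then obtain y where y: "lifts_oriented_edge \<theta> K a z y" "lifted_walk \<theta> K y (b # as) w"
    by auto
  obtain q where q: "path q" "pathstart q = z" "pathfinish q = y"
    "\<And>t. t \<in> {0..1} \<Longrightarrow> univ_cover \<theta> (q t) = oriented_edge_path K a t"
    using lifts_oriented_edge_path[OF y(1)] by metis
  obtain r where r: "path r" "pathstart r = y" "pathfinish r = w"
    "\<forall>t\<in>{0..1}. univ_cover \<theta> (r t) = walk_path K (b # as) t"
    using 3(1)[OF y(2)] by auto
  have "univ_cover \<theta> ((q +++ r) t) = walk_path K (a # b # as) t" if "t \<in> {0..1}" for t
    using q(4)[of "2 * t"] r(4)[rule_format, of "2 * t - 1"] that by (simp add: joinpaths_def)
  with q(1-3) r(1-3) show ?case by (intro exI[of _ "q +++ r"]) auto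
qed

lemma lifts_oriented_edge_ends:
  assumes "lifts_oriented_edge \<theta> K a z w"
  shows "pathstart (oriented_edge_path K a) = univ_cover \<theta> z"
    and "pathfinish (oriented_edge_path K a) = univ_cover \<theta> w"
  using lifts_oriented_edge_path[OF assms] by (metis atLeastAtMost_iff order_refl pathfinish_def pathstart_def zero_le_one)+

lemma lifted_walk_edge_walk:
  assumes "lifted_walk \<theta> K z as w" "as \<noteq> []"
  shows "(\<forall>a\<in>set as. fst a < num_edges K) \<and>
    successively (\<lambda>a b. pathfinish (oriented_edge_path K a) = pathstart (oriented_edge_path K b)) as \<and>
    pathstart (oriented_edge_path K (hd as)) = univ_cover \<theta> z \<and>
    pathfinish (oriented_edge_path K (last as)) = univ_cover \<theta> w"
  using assms
proof (induction as arbitrary: z)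
  case (Cons a as)
  then obtain y where y: "lifts_oriented_edge \<theta> K a z y" "lifted_walk \<theta> K y as w"
    by auto
  have a: "fst a < num_edges K" using y(1) by (cases a) auto
  show ?case
  proof (cases "as = []")
    case True
    then show ?thesis using y a lifts_oriented_edge_ends[OF y(1)] by auto
  next
    case False
    then show ?thesis using Cons.IH[OF y(2) False] a lifts_oriented_edge_ends[OF y(1)]
      by (auto simp: successively_Cons)
  qed
qed simp

lemma deck_group_int_mult: "g \<in> deck_group \<Longrightarrow> of_int a * g \<in> deck_group"
  by (simp add: deck_group_def)

lemma univ_cover_deck:
  assumes "g \<in> deck_group"
  shows "univ_cover \<theta> (z + g) = univ_cover \<theta> z"
proof -
  have "cis (2 * pi * Re (z + g)) = cis (2 * pi * Re z)" "cis (2 * pi * Im (z + g)) = cis (2 * pi * Im z)"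
    unfolding cis_2pi_eq_iff using assms by (simp_all add: deck_group_def)
  then show ?thesis by (simp only: univ_cover_def)
qed

lemma lifted_verts_deck: "z \<in> lifted_verts \<theta> K \<Longrightarrow> g \<in> deck_group \<Longrightarrow> z + g \<in> lifted_verts \<theta> K"
  by (simp add: lifted_verts_def univ_cover_deck)

section \<open>Potentials of 1-forms on the lifted graph\<close>

locale essentially_3_connected_cells =
  fixes S :: "'a::topological_space set" and \<theta> :: "complex \<times> complex \<Rightarrow> 'a" and K :: "'a cells"
  assumes torus: "oriented_torus S \<theta>"
    and cells: "cellular_decomposition S K"
    and connected: "essentially_3_connected \<theta> K"
begin

lemma univ_cover_continuous: "continuous_on A (univ_cover \<theta>)"
proof -
  have "continuous_on (sphere 0 1 \<times> sphere 0 1) \<theta>"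
    using torus by (auto simp: oriented_torus_def homeomorphism_def)
  moreover have "continuous_on A (\<lambda>z. (cis (2 * pi * Re z), cis (2 * pi * Im z)))"
    by (intro continuous_intros)
  ultimately show ?thesis
    unfolding univ_cover_def by (rule continuous_on_compose2) auto
qed

lemma univ_cover_in_torus: "univ_cover \<theta> z \<in> S"
  using torus by (auto simp: oriented_torus_def homeomorphism_def univ_cover_def)

lemma univ_cover_eq_imp_deck:
  assumes "univ_cover \<theta> z = univ_cover \<theta> w"
  shows "z - w \<in> deck_group"
proof -
  obtain \<theta>' where "homeomorphism (sphere (0::complex) 1 \<times> sphere (0::complex) 1) S \<theta> \<theta>'"
    using torus by (auto simp: oriented_torus_def)
  then have "\<theta>' (univ_cover \<theta> u) = (cis (2 * pi * Re u), cis (2 * pi * Im u))" for u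
    by (auto simp: homeomorphism_def univ_cover_def)
  then have "(cis (2 * pi * Re z), cis (2 * pi * Im z)) = (cis (2 * pi * Re w), cis (2 * pi * Im w))"
    using assms by metis
  then show ?thesis by (simp add: cis_2pi_eq_iff deck_group_def)
qed

text \<open>
  In the coordinates \<open>\<theta>\<close> a path in the torus is a pair of paths in the circle.
\<close>

lemma path_lift:
  assumes p: "path p" "path_image p \<subseteq> S"
  obtains q where "path q" "\<And>t. t \<in> {0..1} \<Longrightarrow> univ_cover \<theta> (q t) = p t"
proof -
  obtain \<theta>' where \<theta>': "homeomorphism (sphere (0::complex) 1 \<times> sphere (0::complex) 1) S \<theta> \<theta>'"
    using torus by (auto simp: oriented_torus_def)
  have inS: "p t \<in> S" if "t \<in> {0..1}" for t using p(2) that by (auto simp: path_image_def)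
  have circ: "\<theta>' (p t) \<in> sphere 0 1 \<times> sphere 0 1" if "t \<in> {0..1}" for t
    using \<theta>' inS[OF that] by (auto simp: homeomorphism_def)
  have "continuous_on {0..1} (\<lambda>t. \<theta>' (p t))"
    by (rule continuous_on_compose2[OF homeomorphism_cont2[OF \<theta>'] p[unfolded path_def path_image_def]])
  then have cont: "continuous_on {0..1} (\<lambda>t. fst (\<theta>' (p t)))" "continuous_on {0..1} (\<lambda>t. snd (\<theta>' (p t)))"
    by (simp_all add: continuous_on_fst continuous_on_snd)
  obtain a where a: "continuous_on {0..1} a" "\<And>t. t \<in> {0..1} \<Longrightarrow> fst (\<theta>' (p t)) = cis (2 * pi * a t)"
    using circle_path_lift[OF cont(1)] circ by (metis mem_Times_iff)
  obtain b where b: "continuous_on {0..1} b" "\<And>t. t \<in> {0..1} \<Longrightarrow> snd (\<theta>' (p t)) = cis (2 * pi * b t)"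
    using circle_path_lift[OF cont(2)] circ by (metis mem_Times_iff)
  show ?thesis
  proof
    show "path (\<lambda>t. Complex (a t) (b t))"
      unfolding path_def using a(1) b(1) by (intro continuous_intros)
    fix t :: real assume t: "t \<in> {0..1}"
    have "univ_cover \<theta> (Complex (a t) (b t)) = \<theta> (\<theta>' (p t))"
      by (simp add: univ_cover_def flip: a(2)[OF t] b(2)[OF t])
    also have "\<dots> = p t" using \<theta>' inS[OF t] by (auto simp: homeomorphism_def)
    finally show "univ_cover \<theta> (Complex (a t) (b t)) = p t" .
  qed
qed

lemma edge_path_in_torus:
  assumes "e < num_edges K"
  shows "path (edge_path K e)" and "path_image (edge_path K e) \<subseteq> S"
    and "pathstart (edge_path K e) \<in> vertex_set K" and "pathfinish (edge_path K e) \<in> vertex_set K"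
proof -
  show edge: "path (edge_path K e)" "pathstart (edge_path K e) \<in> vertex_set K"
    "pathfinish (edge_path K e) \<in> vertex_set K"
    using cells assms by (auto simp: cellular_decomposition_def)
  have S: "S = vertex_set K \<union> (\<Union>e<num_edges K. open_edge K e) \<union> (\<Union>f<num_faces K. open_face K f)"
    using cells unfolding cellular_decomposition_def by blast
  show "path_image (edge_path K e) \<subseteq> S"
  proof
    fix x assume "x \<in> path_image (edge_path K e)"
    then obtain t where t: "t \<in> {0..1}" "x = edge_path K e t" by (auto simp: path_image_def)
    consider "t = 0" | "t = 1" | "t \<in> {0<..<1}" using t by force
    then show "x \<in> S"
    proof cases
      case 3
      then have "x \<in> open_edge K e" by (simp add: open_edge_def t)
      then show ?thesis using assms by (subst S) auto
    qed (use edge t S in \<open>auto simp: pathstart_def pathfinish_def\<close>)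
  qed
qed

lemma lift_exists:
  assumes "e < num_edges K"
  shows "\<exists>z w. lifts_edge \<theta> K e z w"
  using path_lift[OF edge_path_in_torus(1,2)[OF assms]] unfolding lifts_edge_def by metis

lemma lifts_some_lift:
  assumes "e < num_edges K"
  shows "lifts_edge \<theta> K e (fst (some_lift \<theta> K e)) (snd (some_lift \<theta> K e))"
proof -
  have "\<exists>x. case x of (z, w) \<Rightarrow> lifts_edge \<theta> K e z w" using lift_exists[OF assms] by auto
  then show ?thesis
    unfolding some_lift_def by (rule someI2_ex) auto
qed

lemma lifts_edge_ends:
  assumes "lifts_edge \<theta> K e z w"
  shows "univ_cover \<theta> z = pathstart (edge_path K e)" "univ_cover \<theta> w = pathfinish (edge_path K e)"
  using assms unfolding lifts_edge_def
  by (metis atLeastAtMost_iff order_refl pathfinish_def pathstart_def zero_le_one)+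

lemma lifts_edge_verts:
  assumes "lifts_edge \<theta> K e z w" "e < num_edges K"
  shows "z \<in> lifted_verts \<theta> K" "w \<in> lifted_verts \<theta> K"
  using lifts_edge_ends[OF assms(1)] edge_path_in_torus[OF assms(2)] by (auto simp: lifted_verts_def)

text \<open>
  Deleting the empty set of vertices, 3-connectedness says that the lifted graph is connected.
\<close>

lemma lifted_walk_exists:
  assumes "z \<in> lifted_verts \<theta> K" "w \<in> lifted_verts \<theta> K"
  shows "\<exists>as. lifted_walk \<theta> K z as w"
proof -
  let ?G = "lifted_graph \<theta> K"
  let ?H = "mk_symmetric (induce_subgraph ?G (verts ?G - {}))"
  have "Digraph_Component.connected (induce_subgraph ?G (verts ?G - {}))"
    using connected unfolding essentially_3_connected_def by (metis card.empty empty_subsetI finite.emptyI le0)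
  then have "reachable (with_proj ?H) z w"
    using assms unfolding Digraph_Component.connected_def strongly_connected_def
    by (auto simp: lifted_graph_def)
  then have "(z, w) \<in> rtrancl_on (verts (with_proj ?H)) (arcs_ends (with_proj ?H))"
    by (simp add: reachable_def)
  then show ?thesis
  proof (induction rule: rtrancl_on_induct)
    case base
    then show ?case using assms(1) by (intro exI[of _ "[]"]) simp
  next
    case (step y x)
    then obtain as where as: "lifted_walk \<theta> K z as y" by blast
    have "(y, x) \<in> parcs ?H" using step(2) by (simp add: arcs_ends_def arc_to_ends_def)
    then obtain e where "e < num_edges K" "lifts_edge \<theta> K e y x \<or> lifts_edge \<theta> K e x y"
      by (auto simp: parcs_mk_symmetric lifted_graph_def)
    then obtain b where "lifted_walk \<theta> K y [(e, b)] x"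
      using lifts_edge_verts by (metis lifted_walk.simps lifts_oriented_edge.simps)
    then show ?case using lifted_walk_append[OF as] by blast
  qed
qed

text \<open>
  The straight-line homotopy in the universal cover from the lifted walk to the segment from \<open>0\<close> to
  \<open>g\<close> keeps the difference of the end points equal to \<open>g\<close>, so it projects to a homotopy of loops.
\<close>

lemma lifted_walk_homotopic_deck_loop:
  assumes walk: "lifted_walk \<theta> K z as (z + g)" "as \<noteq> []" and g: "g \<in> deck_group"
  shows "homotopic_loops S (walk_path K as) (deck_loop \<theta> g)"
proof -
  obtain q where q: "path q" "pathstart q = z" "pathfinish q = z + g"
    "\<And>t. t \<in> {0..1} \<Longrightarrow> univ_cover \<theta> (q t) = walk_path K as t"
    using lifted_walk_path[OF walk] by blast
  let ?H = "\<lambda>x::real \<times> real. (1 - fst x) *\<^sub>R q (snd x) + fst x *\<^sub>R linepath 0 g (snd x)"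
  have q': "continuous_on ({0..1} \<times> {0..1::real}) (\<lambda>x::real \<times> real. q (snd x))"
    by (rule continuous_on_compose2[OF q(1)[unfolded path_def] continuous_on_snd[OF continuous_on_id]]) auto
  have "continuous_on ({0..1} \<times> {0..1}) ?H"
    unfolding linepath_def by (intro continuous_intros q')
  then have "continuous_on ({0..1} \<times> {0..1}) (\<lambda>x. univ_cover \<theta> (?H x))"
    by (rule continuous_on_compose2[OF univ_cover_continuous]) auto
  moreover have "univ_cover \<theta> (?H (s, 1)) = univ_cover \<theta> (?H (s, 0))" for s
  proof -
    have "?H (s, 1) = ?H (s, 0) + g"
      using q(2,3) by (simp add: pathstart_def pathfinish_def linepath_def algebra_simps)
    then show ?thesis by (simp only: univ_cover_deck[OF g])
  qed
  ultimately show ?thesis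
    unfolding homotopic_loops
    by (intro exI[of _ "\<lambda>x. univ_cover \<theta> (?H x)"])
      (auto simp: q(4) deck_loop_def univ_cover_in_torus pathstart_def pathfinish_def)
qed

lemma lifted_walk_period:
  assumes "has_period S \<theta> K \<omega> g x" "g \<in> deck_group" "g \<noteq> 0" "lifted_walk \<theta> K z as (z + g)"
  shows "(\<Sum>a\<leftarrow>as. form_on \<omega> a) = x"
proof -
  have ne: "as \<noteq> []" using assms(3,4) by auto
  have "closed_edge_walk K as"
    using lifted_walk_edge_walk[OF assms(4) ne] ne
    by (simp add: closed_edge_walk_def univ_cover_deck[OF assms(2)])
  then show ?thesis
    using assms(1) lifted_walk_homotopic_deck_loop[OF assms(4) ne assms(2)]
    by (simp add: has_period_def)
qed

text \<open>
  Inserting a closed lifted walk before a walk from \<open>z\<close> to \<open>z + g\<close> does not change its homotopy class,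
  hence not its period: the closed walk contributes nothing.
\<close>

lemma closed_lifted_walk_sum_zero:
  assumes period: "has_period S \<theta> K \<omega> g x" "g \<in> deck_group" "g \<noteq> 0"
    and walk: "lifted_walk \<theta> K z as z" "z \<in> lifted_verts \<theta> K"
  shows "(\<Sum>a\<leftarrow>as. form_on \<omega> a) = 0"
proof -
  obtain bs where bs: "lifted_walk \<theta> K z bs (z + g)"
    using lifted_walk_exists[OF walk(2) lifted_verts_deck[OF walk(2) period(2)]] by blast
  from lifted_walk_period[OF period bs] lifted_walk_period[OF period lifted_walk_append[OF walk(1) bs]]
  show ?thesis by simp
qed

text \<open>
  Summing the form along walks from a base vertex is well defined, since closed lifted walks have
  sum zero.
\<close>

lemma potential_exists:
  assumes p1: "has_period S \<theta> K \<omega> g1 x1" "g1 \<in> deck_group" "g1 \<noteq> 0"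
    and p2: "has_period S \<theta> K \<omega> g2 x2" "g2 \<in> deck_group" "g2 \<noteq> 0"
  obtains M :: "complex \<Rightarrow> real" where
    "\<And>e z w. e < num_edges K \<Longrightarrow> lifts_edge \<theta> K e z w \<Longrightarrow> M w = M z + \<omega> e"
    "\<And>z. z \<in> lifted_verts \<theta> K \<Longrightarrow> M (z + g1) = M z + x1"
    "\<And>z. z \<in> lifted_verts \<theta> K \<Longrightarrow> M (z + g2) = M z + x2"
proof (cases "lifted_verts \<theta> K = {}")
  case True
  then show ?thesis using that[of "\<lambda>_. 0"] lifts_edge_verts by blast
next
  case False
  then obtain base where base: "base \<in> lifted_verts \<theta> K" by blast
  define I where "I as = (\<Sum>a\<leftarrow>as. form_on \<omega> a)" for as
  \<comment> \<open>potential: the sum along some walk from the base vertex\<close>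
  define M where "M z = I (SOME as. lifted_walk \<theta> K base as z)" for z
  have M: "M w = M z + I as" if zw: "z \<in> lifted_verts \<theta> K" "w \<in> lifted_verts \<theta> K" and as: "lifted_walk \<theta> K z as w"
    for z w as
  proof -
    let ?p = "\<lambda>z. SOME as. lifted_walk \<theta> K base as z"
    have p: "lifted_walk \<theta> K base (?p z) z" "lifted_walk \<theta> K base (?p w) w"
      using lifted_walk_exists[OF base] zw by (auto intro: someI_ex)
    obtain bs where bs: "lifted_walk \<theta> K w bs base" using lifted_walk_exists zw(2) base by blast
    note zero = closed_lifted_walk_sum_zero[OF p1 _ base, folded I_def]
    \<comment> \<open>two closed walks through the base vertex, with the same return walk from \<open>w\<close>\<close>
    have "I (?p w @ bs) = 0" by (rule zero[OF lifted_walk_append[OF p(2) bs]])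
    moreover have "I (?p z @ as @ bs) = 0"
      by (rule zero[OF lifted_walk_append[OF p(1) lifted_walk_append[OF as bs]]])
    ultimately show ?thesis by (simp add: M_def I_def)
  qed
  have period: "M (z + g) = M z + x"
    if g: "has_period S \<theta> K \<omega> g x" "g \<in> deck_group" "g \<noteq> 0" and z: "z \<in> lifted_verts \<theta> K" for g x z
  proof -
    have zg: "z + g \<in> lifted_verts \<theta> K" using lifted_verts_deck[OF z g(2)] .
    then obtain as where as: "lifted_walk \<theta> K z as (z + g)" using lifted_walk_exists z by blast
    show ?thesis using M[OF z zg as] lifted_walk_period[OF g as] by (simp add: I_def)
  qed
  show ?thesis
  proof
    fix e z w assume e: "e < num_edges K" "lifts_edge \<theta> K e z w"
    then have "lifted_walk \<theta> K z [(e, True)] w" using lifts_edge_verts(2) by auto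
    from M[OF _ _ this] show "M w = M z + \<omega> e"
      using lifts_edge_verts[OF e(2,1)] by (simp add: I_def form_on_def)
  qed (use period p1 p2 in auto)
qed

lemma constant_if_constant_along_edges:
  assumes edges: "\<And>e z w. e < num_edges K \<Longrightarrow> lifts_edge \<theta> K e z w \<Longrightarrow> F w = F z"
    and "z \<in> lifted_verts \<theta> K" "w \<in> lifted_verts \<theta> K"
  shows "F z = F w"
proof -
  have "F z = F w" if "lifted_walk \<theta> K z as w" for as z w
    using that
  proof (induction as arbitrary: z)
    case (Cons a as)
    then obtain y where y: "lifts_oriented_edge \<theta> K a z y" "lifted_walk \<theta> K y as w" by auto
    have "F z = F y" using y(1) edges by (cases a) (auto split: if_splits)
    then show ?case using Cons.IH[OF y(2)] by simp
  qed simp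
  then show ?thesis using lifted_walk_exists assms(2,3) by blast
qed

section \<open>Functions on the vertices\<close>

definition vertex_below :: "complex \<Rightarrow> nat" where
  "vertex_below z = the_inv_into {..<num_verts K} (vertex_point K) (univ_cover \<theta> z)"

lemma vertex_below:
  assumes "z \<in> lifted_verts \<theta> K"
  shows "vertex_below z < num_verts K" "vertex_point K (vertex_below z) = univ_cover \<theta> z"
proof -
  have inj: "inj_on (vertex_point K) {..<num_verts K}"
    using cells by (simp add: cellular_decomposition_def)
  have im: "univ_cover \<theta> z \<in> vertex_point K ` {..<num_verts K}"
    using assms by (simp add: lifted_verts_def vertex_set_def)
  show "vertex_below z < num_verts K"
    using the_inv_into_into[OF inj im order_refl] by (simp add: vertex_below_def)
  show "vertex_point K (vertex_below z) = univ_cover \<theta> z"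
    unfolding vertex_below_def by (rule f_the_inv_into_f[OF inj im])
qed

lemma vertex_below_deck:
  "g \<in> deck_group \<Longrightarrow> vertex_below (z + g) = vertex_below z"
  by (simp add: vertex_below_def univ_cover_deck)

lemma vertex_below_surj:
  assumes "i < num_verts K"
  obtains z where "z \<in> lifted_verts \<theta> K" "vertex_below z = i"
proof -
  have i: "vertex_point K i \<in> vertex_set K" using assms by (simp add: vertex_set_def)
  moreover have "vertex_set K \<subseteq> S" using cells unfolding cellular_decomposition_def by blast
  ultimately have "path_image (\<lambda>t::real. vertex_point K i) \<subseteq> S" by (auto simp: path_image_def)
  moreover have "path (\<lambda>t::real. vertex_point K i)" by (simp add: path_def)
  ultimately obtain q where q: "\<And>t. t \<in> {0..1::real} \<Longrightarrow> univ_cover \<theta> (q t) = vertex_point K i"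
    using path_lift[of "\<lambda>t. vertex_point K i"] by metis
  then have u: "univ_cover \<theta> (q 0) = vertex_point K i" by simp
  then have "q 0 \<in> lifted_verts \<theta> K" using i by (simp add: lifted_verts_def)
  moreover have "vertex_below (q 0) = i"
    unfolding vertex_below_def u
    by (rule the_inv_into_f_f) (use assms cells in \<open>auto simp: cellular_decomposition_def\<close>)
  ultimately show ?thesis by (rule that)
qed

text \<open>
  The incidence matrix acts on a function of the vertices as the gradient.  Scalars are coerced so
  that the complex-valued functions of the energy are covered as well.
\<close>

lemma incidence_sum:
  fixes f :: "nat \<Rightarrow> 'b::real_algebra_1"
  assumes "e < num_edges K" "lifts_edge \<theta> K e z w"
  shows "(\<Sum>i<num_verts K. of_real (incidence_entry K e i) * f i) = f (vertex_below w) - f (vertex_below z)"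
proof -
  note zw = lifts_edge_verts[OF assms(2,1)]
  have inj: "inj_on (vertex_point K) {..<num_verts K}"
    using cells by (simp add: cellular_decomposition_def)
  have ind: "univ_cover \<theta> u = vertex_point K i \<longleftrightarrow> vertex_below u = i"
    if "u \<in> lifted_verts \<theta> K" "i < num_verts K" for u i
    using vertex_below[OF that(1)] inj that(2) by (auto dest: inj_onD)
  have "(\<Sum>i<num_verts K. of_real (incidence_entry K e i) * f i) =
      (\<Sum>i<num_verts K. (if vertex_below w = i then f i else 0) - (if vertex_below z = i then f i else 0))"
    by (intro sum.cong refl)
      (auto simp: incidence_entry_def ind zw left_diff_distrib simp flip: lifts_edge_ends[OF assms(2)])
  also have "\<dots> = f (vertex_below w) - f (vertex_below z)"
    using vertex_below(1) zw by (simp add: sum_subtractf)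
  finally show ?thesis .
qed

text \<open>
  Two lifts of one vertex differ by an integral combination of the generators.
\<close>

lemma deck_invariant_factors:
  assumes g: "positive_generators g1 g2"
    and k1: "\<And>z. z \<in> lifted_verts \<theta> K \<Longrightarrow> k (z + g1) = k z"
    and k2: "\<And>z. z \<in> lifted_verts \<theta> K \<Longrightarrow> k (z + g2) = k z"
  obtains f where "\<And>z. z \<in> lifted_verts \<theta> K \<Longrightarrow> k z = f (vertex_below z)"
proof
  have mult: "k (z + of_int a * g) = k z"
    if g: "g \<in> deck_group" and k: "\<And>z. z \<in> lifted_verts \<theta> K \<Longrightarrow> k (z + g) = k z"
      and z: "z \<in> lifted_verts \<theta> K" for g z a
  proof (induction a rule: int_induct[where k = 0])
    case (step1 i)
    have "z + of_int i * g \<in> lifted_verts \<theta> K" by (intro lifted_verts_deck deck_group_int_mult z g)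
    from k[OF this] show ?case using step1 by (simp add: algebra_simps)
  next
    case (step2 i)
    have "z + of_int (i - 1) * g \<in> lifted_verts \<theta> K" by (intro lifted_verts_deck deck_group_int_mult z g)
    from k[OF this] show ?case using step2 by (simp add: algebra_simps)
  qed simp
  define f where "f i = k (SOME z. z \<in> lifted_verts \<theta> K \<and> vertex_below z = i)" for i
  fix z assume z: "z \<in> lifted_verts \<theta> K"
  let ?y = "SOME y. y \<in> lifted_verts \<theta> K \<and> vertex_below y = vertex_below z"
  have y: "?y \<in> lifted_verts \<theta> K \<and> vertex_below ?y = vertex_below z"
    by (rule someI[of _ z]) (simp add: z)
  then have "univ_cover \<theta> z = univ_cover \<theta> ?y" using vertex_below(2) z by metis
  then have "z - ?y \<in> deck_group" by (rule univ_cover_eq_imp_deck)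
  then obtain a b :: int where "z - ?y = of_int a * g1 + of_int b * g2"
    using g unfolding positive_generators_def by blast
  then have eq: "z = (?y + of_int a * g1) + of_int b * g2" by (simp add: algebra_simps)
  have gd: "g1 \<in> deck_group" "g2 \<in> deck_group" using g by (auto simp: positive_generators_def)
  have "k ((?y + of_int a * g1) + of_int b * g2) = k (?y + of_int a * g1)"
    by (rule mult[OF gd(2) k2]) (use y gd in \<open>auto intro!: lifted_verts_deck deck_group_int_mult\<close>)
  also have "\<dots> = k ?y" by (rule mult[OF gd(1) k1]) (use y in auto)
  finally show "k z = f (vertex_below z)" unfolding f_def using eq by simp
qed

end

section \<open>Harmonic representatives and the determinant ratio\<close>

lemma sum_insert_index:
  fixes g :: "nat \<Rightarrow> 'b::comm_monoid_add"
  assumes "v < Suc n"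
  shows "(\<Sum>i<Suc n. g i) = g v + (\<Sum>i<n. g (insert_index v i))"
proof -
  have "(\<Sum>i<n. g (insert_index v i)) = sum g (insert_index v ` {0..<n})"
    by (simp add: sum.reindex insert_index_inj_on lessThan_atLeast0)
  also have "\<dots> = sum g ({..<Suc n} - {v})"
    by (simp add: insert_index_image[OF assms] lessThan_atLeast0)
  finally show ?thesis using assms by (simp add: sum.remove[of "{..<Suc n}" v] del: sum.lessThan_Suc)
qed

context essentially_3_connected_cells
begin

lemma incidence_gradient:
  assumes "e < num_edges K" "lifts_edge \<theta> K e z w"
  shows "(\<Sum>i<num_verts K. incidence_entry K e i * f i) = f (vertex_below w) - f (vertex_below z)"
  using incidence_sum[OF assms, of f] by simp

lemma incidence_row_sum:
  assumes "e < num_edges K"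
  shows "(\<Sum>i<num_verts K. incidence_entry K e i) = 0"
proof -
  obtain z w where "lifts_edge \<theta> K e z w" using lift_exists[OF assms] by blast
  from incidence_gradient[OF assms this, of "\<lambda>_. 1"] show ?thesis by simp
qed

text \<open>
  A function with zero gradient is constant because the lifted graph is connected.
\<close>

lemma incidence_kernel_constant:
  assumes "\<And>e. e < num_edges K \<Longrightarrow> (\<Sum>i<num_verts K. incidence_entry K e i * f i) = 0"
    and "i < num_verts K" "j < num_verts K"
  shows "f i = f j"
proof -
  obtain z where z: "z \<in> lifted_verts \<theta> K" "vertex_below z = i" using vertex_below_surj assms(2) by blast
  obtain w where w: "w \<in> lifted_verts \<theta> K" "vertex_below w = j" using vertex_below_surj assms(3) by blast
  have "f (vertex_below z) = f (vertex_below w)"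
    by (rule constant_if_constant_along_edges[OF _ z(1) w(1), of "\<lambda>z. f (vertex_below z)"])
      (use assms(1) incidence_gradient in force)
  then show ?thesis by (simp add: z w)
qed

text \<open>
  Deleting the row and column of \<open>v0\<close> restricts to functions that vanish at \<open>v0\<close>; on these the
  gradient is injective, so the reduced Laplacian is invertible and \<open>m1\<close>, \<open>m2\<close> have harmonic
  representatives \<open>\<mu>1\<close>, \<open>\<mu>2\<close>.  Their Gram matrix is the Schur complement of the reduced Laplacian.
\<close>

lemma determinant_ratio:
  assumes c: "\<And>e. e < num_edges K \<Longrightarrow> 0 < c e" and v0: "v0 < num_verts K"
  obtains \<mu>1 f1 \<mu>2 f2 where
    "\<And>e. \<mu>1 e = m1 e + (\<Sum>i<num_verts K. incidence_entry K e i * f1 i)"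
    "\<And>e. \<mu>2 e = m2 e + (\<Sum>i<num_verts K. incidence_entry K e i * f2 i)"
    "\<And>i. i < num_verts K \<Longrightarrow> (\<Sum>e<num_edges K. c e * incidence_entry K e i * \<mu>1 e) = 0"
    "\<And>i. i < num_verts K \<Longrightarrow> (\<Sum>e<num_edges K. c e * incidence_entry K e i * \<mu>2 e) = 0"
    "det0 v0 (transpose_mat (d_tilde_mat K m1 m2) * weight_mat K c * d_tilde_mat K m1 m2)
       / det0 v0 (transpose_mat (d_mat K) * weight_mat K c * d_mat K) =
     (\<Sum>e<num_edges K. c e * (\<mu>1 e)\<^sup>2) * (\<Sum>e<num_edges K. c e * (\<mu>2 e)\<^sup>2) -
     (\<Sum>e<num_edges K. c e * \<mu>1 e * \<mu>2 e)\<^sup>2"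
proof -
  obtain n where n: "num_verts K = Suc n" using v0 by (cases "num_verts K") auto
  let ?m = "num_edges K" and ?inc = "incidence_entry K"
  define ins where "ins = insert_index v0"
  define b where "b e i = (if ins i < Suc n then ?inc e (ins i) else if ins i = Suc n then m1 e else m2 e)"
    for e i
  have ins: "ins i < Suc n" if "i < n" for i using that by (simp add: ins_def insert_index_def)
  have bn: "b e i = ?inc e (ins i)" if "i < n" for e i using ins[OF that] by (simp add: b_def)
  have bm: "b e n = m1 e" "b e (Suc n) = m2 e" for e
    using v0 n by (simp_all add: b_def ins_def insert_index_def)
  have split: "(\<Sum>i<num_verts K. g i) = g v0 + (\<Sum>i<n. g (ins i))" for g :: "nat \<Rightarrow> real"
    using sum_insert_index[of v0 n g] v0 by (simp only: n ins_def)
  \<comment> \<open>extension by zero at \<open>v0\<close> of a function on the remaining vertices\<close>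
  define ext where "ext x i = (if i = v0 then 0 else x (delete_index v0 i))" for x :: "nat \<Rightarrow> real" and i
  have ext: "(\<Sum>i<num_verts K. ?inc e i * ext x i) = (\<Sum>i<n. b e i * x i)" for e x
    unfolding split by (simp add: ext_def ins_def bn[unfolded ins_def])
  have det_d: "det0 v0 (transpose_mat (d_mat K) * weight_mat K c * d_mat K) =
      Determinant.det (weighted_gram ?m n c b)"
  proof -
    have "mat_delete (weighted_gram ?m (Suc n) c ?inc) v0 v0 = weighted_gram ?m n c b"
      unfolding mat_delete_weighted_gram
      by (auto simp: weighted_gram_def bn ins_def intro!: eq_matI)
    then show ?thesis
      unfolding det0_def d_mat_def weight_mat_def weighted_gram_eq_product n by simp
  qed
  have det_dt: "det0 v0 (transpose_mat (d_tilde_mat K m1 m2) * weight_mat K c * d_tilde_mat K m1 m2) =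
      Determinant.det (weighted_gram ?m (n + 2) c b)"
    unfolding det0_def d_tilde_mat_def weight_mat_def weighted_gram_eq_product n
    by (simp add: mat_delete_weighted_gram b_def[abs_def] flip: ins_def)
  have nz: "Determinant.det (weighted_gram ?m n c b) \<noteq> 0"
  proof (rule det_weighted_gram_nonzero[OF c])
    fix x i assume 0: "\<And>e. e < ?m \<Longrightarrow> (\<Sum>i<n. b e i * x i) = 0" and i: "i < n"
    have "(\<Sum>j<num_verts K. ?inc e j * ext x j) = 0" if "e < ?m" for e
      using 0[OF that] by (simp only: ext)
    then have "ext x (ins i) = ext x v0"
      by (rule incidence_kernel_constant) (use ins[OF i] v0 n in simp_all)
    then show "x i = 0" by (simp add: ext_def ins_def)
  qed
  obtain x1 where x1: "\<And>i. i < n \<Longrightarrow> (\<Sum>e<?m. c e * b e i * (m1 e + (\<Sum>j<n. b e j * x1 j))) = 0"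
    using weighted_gram_normal_equation[OF nz, of m1] by blast
  obtain x2 where x2: "\<And>i. i < n \<Longrightarrow> (\<Sum>e<?m. c e * b e i * (m2 e + (\<Sum>j<n. b e j * x2 j))) = 0"
    using weighted_gram_normal_equation[OF nz, of m2] by blast
  \<comment> \<open>the column of \<open>v0\<close> is minus the sum of the others, so orthogonality to it is automatic\<close>
  have all: "(\<Sum>e<?m. c e * ?inc e i * \<mu> e) = 0"
    if orth: "\<And>i. i < n \<Longrightarrow> (\<Sum>e<?m. c e * b e i * \<mu> e) = 0" and i: "i < num_verts K" for \<mu> i
  proof (cases "i = v0")
    case False
    then obtain j where j: "i = ins j" "j < n"
      using i False v0 n insert_index_image[of v0 n] unfolding ins_def
      by (metis (no_types, lifting) DiffI atLeast0LessThan imageE lessThan_iff singletonD)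
    then show ?thesis using orth[OF j(2)] by (simp add: bn)
  next
    case True
    have "(\<Sum>i<num_verts K. \<Sum>e<?m. c e * ?inc e i * \<mu> e) = (\<Sum>e<?m. c e * (\<Sum>i<num_verts K. ?inc e i) * \<mu> e)"
      by (subst sum.swap) (simp add: sum_distrib_left sum_distrib_right)
    also have "\<dots> = 0" by (simp add: incidence_row_sum)
    finally have "(\<Sum>e<?m. c e * ?inc e v0 * \<mu> e) + (\<Sum>i<n. \<Sum>e<?m. c e * ?inc e (ins i) * \<mu> e) = 0"
      unfolding split .
    moreover have "(\<Sum>e<?m. c e * ?inc e (ins i) * \<mu> e) = 0" if "i < n" for i
      using orth[OF that] by (simp add: bn[OF that])
    ultimately show ?thesis using True by simp
  qed
  show ?thesis
  proof
    show "(\<Sum>e<?m. c e * ?inc e i * (m1 e + (\<Sum>j<n. b e j * x1 j))) = 0" if "i < num_verts K" for i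
      by (rule all[OF x1 that])
    show "(\<Sum>e<?m. c e * ?inc e i * (m2 e + (\<Sum>j<n. b e j * x2 j))) = 0" if "i < num_verts K" for i
      by (rule all[OF x2 that])
    show "m1 e + (\<Sum>j<n. b e j * x1 j) = m1 e + (\<Sum>i<num_verts K. ?inc e i * ext x1 i)" for e
      by (simp add: ext)
    show "m2 e + (\<Sum>j<n. b e j * x2 j) = m2 e + (\<Sum>i<num_verts K. ?inc e i * ext x2 i)" for e
      by (simp add: ext)
  qed (use det_weighted_gram_extension[where n = n and m = ?m and c = c and b = b and ?x1.0 = x1 and ?x2.0 = x2] nz x1 x2 in \<open>simp add: det_d det_dt bm\<close>)
qed

section \<open>The Dirichlet energy of straight-line maps\<close>

text \<open>
  If the form \<open>a \<mu>1 + b \<mu>2\<close> vanishes on every edge, its potential is constant by connectedness, so its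
  periods \<open>a\<close> and \<open>b\<close> vanish.
\<close>

lemma period_form_positive_definite:
  assumes c: "\<And>e. e < num_edges K \<Longrightarrow> 0 < c e"
    and M1: "\<And>e z w. e < num_edges K \<Longrightarrow> lifts_edge \<theta> K e z w \<Longrightarrow> M1 w = M1 z + \<mu>1 e"
      "\<And>z. z \<in> lifted_verts \<theta> K \<Longrightarrow> M1 (z + g1) = M1 z + 1"
      "\<And>z. z \<in> lifted_verts \<theta> K \<Longrightarrow> M1 (z + g2) = M1 z"
    and M2: "\<And>e z w. e < num_edges K \<Longrightarrow> lifts_edge \<theta> K e z w \<Longrightarrow> M2 w = M2 z + \<mu>2 e"
      "\<And>z. z \<in> lifted_verts \<theta> K \<Longrightarrow> M2 (z + g1) = M2 z"
      "\<And>z. z \<in> lifted_verts \<theta> K \<Longrightarrow> M2 (z + g2) = M2 z + 1"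
    and g: "g1 \<in> deck_group" "g2 \<in> deck_group" and z: "z \<in> lifted_verts \<theta> K"
    and ab: "(a, b) \<noteq> (0::real, 0)"
  shows "0 < (\<Sum>e<num_edges K. c e * (a * \<mu>1 e + b * \<mu>2 e)\<^sup>2)"
proof -
  let ?q = "\<lambda>e. c e * (a * \<mu>1 e + b * \<mu>2 e)\<^sup>2"
  have nn: "0 \<le> ?q e" if "e \<in> {..<num_edges K}" for e
    using c[of e] that by (intro mult_nonneg_nonneg) (auto simp: less_imp_le)
  have "(\<Sum>e<num_edges K. ?q e) \<noteq> 0"
  proof
    assume "(\<Sum>e<num_edges K. ?q e) = 0"
    then have "?q e = 0" if "e < num_edges K" for e
      using sum_nonneg_eq_0_iff[OF finite_lessThan nn] that by auto
    then have zero: "a * \<mu>1 e + b * \<mu>2 e = 0" if "e < num_edges K" for e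
      using c[of e] that by fastforce
    have const: "a * M1 z + b * M2 z = a * M1 w + b * M2 w" if "w \<in> lifted_verts \<theta> K" for w
    proof (rule constant_if_constant_along_edges[OF _ z that, of "\<lambda>z. a * M1 z + b * M2 z"])
      fix e x y assume "e < num_edges K" "lifts_edge \<theta> K e x y"
      then show "a * M1 y + b * M2 y = a * M1 x + b * M2 x"
        using M1(1) M2(1) zero[of e] by (simp add: algebra_simps)
    qed
    have "a = 0" using const[OF lifted_verts_deck[OF z g(1)]] by (simp add: M1 M2 z distrib_left)
    moreover have "b = 0" using const[OF lifted_verts_deck[OF z g(2)]] by (simp add: M1 M2 z distrib_left)
    ultimately show False using ab by simp
  qed
  moreover have "0 \<le> (\<Sum>e<num_edges K. ?q e)" by (rule sum_nonneg[OF nn])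
  ultimately show ?thesis by simp
qed

text \<open>
  The edge vectors of \<open>h\<close> are those of the harmonic map with the same \<open>\<tau>\<close> plus the gradient of a
  function on the vertices, and the two are orthogonal.
\<close>

lemma dirichlet_energy_lower_bound:
  assumes c: "\<And>e. e < num_edges K \<Longrightarrow> 0 < c e"
    and g: "positive_generators g1 g2"
    and M1: "\<And>e z w. e < num_edges K \<Longrightarrow> lifts_edge \<theta> K e z w \<Longrightarrow> M1 w = M1 z + \<mu>1 e"
      "\<And>z. z \<in> lifted_verts \<theta> K \<Longrightarrow> M1 (z + g1) = M1 z + 1"
      "\<And>z. z \<in> lifted_verts \<theta> K \<Longrightarrow> M1 (z + g2) = M1 z"
    and M2: "\<And>e z w. e < num_edges K \<Longrightarrow> lifts_edge \<theta> K e z w \<Longrightarrow> M2 w = M2 z + \<mu>2 e"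
      "\<And>z. z \<in> lifted_verts \<theta> K \<Longrightarrow> M2 (z + g1) = M2 z"
      "\<And>z. z \<in> lifted_verts \<theta> K \<Longrightarrow> M2 (z + g2) = M2 z + 1"
    and \<mu>1: "\<And>i. i < num_verts K \<Longrightarrow> (\<Sum>e<num_edges K. c e * incidence_entry K e i * \<mu>1 e) = 0"
    and \<mu>2: "\<And>i. i < num_verts K \<Longrightarrow> (\<Sum>e<num_edges K. c e * incidence_entry K e i * \<mu>2 e) = 0"
    and h: "straight_line_map \<theta> K g1 g2 \<tau> h"
  defines "\<alpha> \<equiv> 1 / of_real (sqrt (Im \<tau>)) :: complex" and "\<beta> \<equiv> \<tau> / of_real (sqrt (Im \<tau>))"
  shows "1 / 2 * (\<Sum>e<num_edges K. c e * (cmod (\<alpha> * of_real (\<mu>1 e) + \<beta> * of_real (\<mu>2 e)))\<^sup>2) \<le>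
    dirichlet_energy \<theta> K c h"
proof -
  let ?\<eta> = "\<lambda>e. \<alpha> * of_real (\<mu>1 e) + \<beta> * of_real (\<mu>2 e)"
  have h1: "h (z + g1) = h z + \<alpha>" and h2: "h (z + g2) = h z + \<beta>" if "z \<in> lifted_verts \<theta> K" for z
    using h that by (simp_all add: straight_line_map_def \<alpha>_def \<beta>_def)
  obtain f where f: "\<And>z. z \<in> lifted_verts \<theta> K \<Longrightarrow>
      h z - \<alpha> * of_real (M1 z) - \<beta> * of_real (M2 z) = f (vertex_below z)"
    by (rule deck_invariant_factors[OF g, of "\<lambda>z. h z - \<alpha> * of_real (M1 z) - \<beta> * of_real (M2 z)"])
      (auto simp: h1 h2 M1 M2 algebra_simps)
  let ?\<delta> = "\<lambda>e. \<Sum>i<num_verts K. of_real (incidence_entry K e i) * f i"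
  have edge: "h (snd (some_lift \<theta> K e)) - h (fst (some_lift \<theta> K e)) = ?\<delta> e + ?\<eta> e"
    if e: "e < num_edges K" for e
  proof -
    let ?z = "fst (some_lift \<theta> K e)" and ?w = "snd (some_lift \<theta> K e)"
    note l = lifts_some_lift[OF e]
    note zw = lifts_edge_verts[OF l e]
    show ?thesis unfolding incidence_sum[OF e l]
      using M1(1)[OF e l] M2(1)[OF e l] by (simp add: algebra_simps flip: f[OF zw(1)] f[OF zw(2)])
  qed
  have orth: "(\<Sum>e<num_edges K. of_real (c e * incidence_entry K e i) * ?\<eta> e) = 0" if "i < num_verts K" for i
  proof -
    have "(\<Sum>e<num_edges K. of_real (c e * incidence_entry K e i) * ?\<eta> e) =
        \<alpha> * of_real (\<Sum>e<num_edges K. c e * incidence_entry K e i * \<mu>1 e) +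
        \<beta> * of_real (\<Sum>e<num_edges K. c e * incidence_entry K e i * \<mu>2 e)"
      by (simp add: sum_distrib_left sum.distrib algebra_simps)
    then show ?thesis by (simp only: \<mu>1[OF that] \<mu>2[OF that]) simp
  qed
  have "dirichlet_energy \<theta> K c h = 1 / 2 * (\<Sum>e<num_edges K. c e * (cmod (?\<delta> e + ?\<eta> e))\<^sup>2)"
    by (simp add: dirichlet_energy_def edge)
  also have "(\<Sum>e<num_edges K. c e * (cmod (?\<delta> e + ?\<eta> e))\<^sup>2) =
      (\<Sum>e<num_edges K. c e * (cmod (?\<delta> e))\<^sup>2) + (\<Sum>e<num_edges K. c e * (cmod (?\<eta> e))\<^sup>2)"
    by (rule weighted_pythagoras[OF orth])
  finally show ?thesis
    using sum_nonneg[of "{..<num_edges K}" "\<lambda>e. c e * (cmod (?\<delta> e))\<^sup>2"] c by (simp add: less_imp_le)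
qed

lemma dirichlet_energy_of_potentials:
  assumes M1: "\<And>e z w. e < num_edges K \<Longrightarrow> lifts_edge \<theta> K e z w \<Longrightarrow> M1 w = M1 z + \<mu>1 e"
    and M2: "\<And>e z w. e < num_edges K \<Longrightarrow> lifts_edge \<theta> K e z w \<Longrightarrow> M2 w = M2 z + \<mu>2 e"
  shows "dirichlet_energy \<theta> K c (\<lambda>z. \<alpha> * of_real (M1 z) + \<beta> * of_real (M2 z)) =
    1 / 2 * (\<Sum>e<num_edges K. c e * (cmod (\<alpha> * of_real (\<mu>1 e) + \<beta> * of_real (\<mu>2 e)))\<^sup>2)"
proof -
  have "\<alpha> * of_real (M1 w) + \<beta> * of_real (M2 w) - (\<alpha> * of_real (M1 z) + \<beta> * of_real (M2 z)) =
      \<alpha> * of_real (\<mu>1 e) + \<beta> * of_real (\<mu>2 e)"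
    if "e < num_edges K" "lifts_edge \<theta> K e z w" for e z w
    using M1[OF that] M2[OF that] by (simp add: algebra_simps)
  then show ?thesis by (simp add: dirichlet_energy_def lifts_some_lift)
qed

end

theorem theorem1p2:
  fixes S :: "'a::topological_space set"
    and \<theta> :: "complex \<times> complex \<Rightarrow> 'a"
    and K :: "'a cells"
    and g1 g2 :: complex
    and c m1 m2 :: "nat \<Rightarrow> real"
    and v0 :: nat
  assumes "oriented_torus S \<theta>"
    and "positive_generators g1 g2"
    and "cellular_decomposition S K"
    and "\<forall>f<num_faces K. 3 \<le> length (face_boundary K f)"
    and "essentially_3_connected \<theta> K"
    and "\<forall>e<num_edges K. 0 < c e"
    and "closed_form K m1" and "has_period S \<theta> K m1 g1 1" and "has_period S \<theta> K m1 g2 0"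
    and "closed_form K m2" and "has_period S \<theta> K m2 g1 0" and "has_period S \<theta> K m2 g2 1"
    and "v0 < num_verts K"
  shows "\<exists>\<tau> h.
           is_arg_min (\<lambda>(\<tau>, h). dirichlet_energy \<theta> K c h)
             (\<lambda>(\<tau>, h). 0 < Im \<tau> \<and> straight_line_map \<theta> K g1 g2 \<tau> h) (\<tau>, h) \<and>
           dirichlet_energy \<theta> K c h =
             sqrt (det0 v0 (transpose_mat (d_tilde_mat K m1 m2) * weight_mat K c * d_tilde_mat K m1 m2)
                   / det0 v0 (transpose_mat (d_mat K) * weight_mat K c * d_mat K))"
proof -
  interpret essentially_3_connected_cells S \<theta> K
    by unfold_locales (fact assms)+
  let ?E = "{..<num_edges K}"
  note generators = \<open>positive_generators g1 g2\<close>
  have c: "0 < c e" if "e < num_edges K" for e using assms(6) that by blast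
  have deck: "g1 \<in> deck_group" "g2 \<in> deck_group" and nonzero: "g1 \<noteq> 0" "g2 \<noteq> 0"
    using generators by (auto simp: positive_generators_def intersection_number_def)
  obtain \<mu>1 f1 \<mu>2 f2 where \<mu>1: "\<And>e. \<mu>1 e = m1 e + (\<Sum>i<num_verts K. incidence_entry K e i * f1 i)"
    and \<mu>2: "\<And>e. \<mu>2 e = m2 e + (\<Sum>i<num_verts K. incidence_entry K e i * f2 i)"
    and harmonic1: "\<And>i. i < num_verts K \<Longrightarrow> (\<Sum>e\<in>?E. c e * incidence_entry K e i * \<mu>1 e) = 0"
    and harmonic2: "\<And>i. i < num_verts K \<Longrightarrow> (\<Sum>e\<in>?E. c e * incidence_entry K e i * \<mu>2 e) = 0"
    and ratio: "det0 v0 (transpose_mat (d_tilde_mat K m1 m2) * weight_mat K c * d_tilde_mat K m1 m2)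
        / det0 v0 (transpose_mat (d_mat K) * weight_mat K c * d_mat K) =
      (\<Sum>e\<in>?E. c e * (\<mu>1 e)\<^sup>2) * (\<Sum>e\<in>?E. c e * (\<mu>2 e)\<^sup>2) - (\<Sum>e\<in>?E. c e * \<mu>1 e * \<mu>2 e)\<^sup>2"
  proof -
    show ?thesis
      by (rule determinant_ratio[where c = c and ?m1.0 = m1 and ?m2.0 = m2, OF _ \<open>v0 < num_verts K\<close>])
        (fact c that)+
  qed
  \<comment> \<open>adding \<open>f\<close> to the potential of \<open>m\<close> preserves the periods, as \<open>f\<close> is a function on the vertices\<close>
  have potential: "\<exists>M. (\<forall>e z w. e < num_edges K \<longrightarrow> lifts_edge \<theta> K e z w \<longrightarrow> M w = M z + \<mu> e) \<and>
      (\<forall>z\<in>lifted_verts \<theta> K. M (z + g1) = M z + x1 \<and> M (z + g2) = M z + x2)"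
    if per: "has_period S \<theta> K m g1 x1" "has_period S \<theta> K m g2 x2"
      and \<mu>: "\<And>e. \<mu> e = m e + (\<Sum>i<num_verts K. incidence_entry K e i * f i)" for m \<mu> f x1 x2
  proof -
    obtain M where M: "\<And>e z w. e < num_edges K \<Longrightarrow> lifts_edge \<theta> K e z w \<Longrightarrow> M w = M z + m e"
      "\<And>z. z \<in> lifted_verts \<theta> K \<Longrightarrow> M (z + g1) = M z + x1"
      "\<And>z. z \<in> lifted_verts \<theta> K \<Longrightarrow> M (z + g2) = M z + x2"
      using potential_exists[where \<omega> = m, OF per(1) deck(1) nonzero(1) per(2) deck(2) nonzero(2)] by metis
    show ?thesis
      by (rule exI[of _ "\<lambda>z. M z + f (vertex_below z)"])
        (auto simp: M \<mu> incidence_gradient vertex_below_deck deck)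
  qed
  obtain M1 where "\<forall>e z w. e < num_edges K \<longrightarrow> lifts_edge \<theta> K e z w \<longrightarrow> M1 w = M1 z + \<mu>1 e"
    "\<forall>z\<in>lifted_verts \<theta> K. M1 (z + g1) = M1 z + 1 \<and> M1 (z + g2) = M1 z + 0"
    using potential[OF assms(8,9) \<mu>1] by blast
  then have M1: "\<And>e z w. e < num_edges K \<Longrightarrow> lifts_edge \<theta> K e z w \<Longrightarrow> M1 w = M1 z + \<mu>1 e"
    "\<And>z. z \<in> lifted_verts \<theta> K \<Longrightarrow> M1 (z + g1) = M1 z + 1"
    "\<And>z. z \<in> lifted_verts \<theta> K \<Longrightarrow> M1 (z + g2) = M1 z"
    by simp_all
  obtain M2 where "\<forall>e z w. e < num_edges K \<longrightarrow> lifts_edge \<theta> K e z w \<longrightarrow> M2 w = M2 z + \<mu>2 e"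
    "\<forall>z\<in>lifted_verts \<theta> K. M2 (z + g1) = M2 z + 0 \<and> M2 (z + g2) = M2 z + 1"
    using potential[OF assms(11,12) \<mu>2] by blast
  then have M2: "\<And>e z w. e < num_edges K \<Longrightarrow> lifts_edge \<theta> K e z w \<Longrightarrow> M2 w = M2 z + \<mu>2 e"
    "\<And>z. z \<in> lifted_verts \<theta> K \<Longrightarrow> M2 (z + g1) = M2 z"
    "\<And>z. z \<in> lifted_verts \<theta> K \<Longrightarrow> M2 (z + g2) = M2 z + 1"
    by simp_all
  obtain z0 where z0: "z0 \<in> lifted_verts \<theta> K" using vertex_below_surj \<open>v0 < num_verts K\<close> by blast
  define p where "p = (\<Sum>e\<in>?E. c e * (\<mu>1 e)\<^sup>2)"
  define r where "r = (\<Sum>e\<in>?E. c e * \<mu>1 e * \<mu>2 e)"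
  define s where "s = (\<Sum>e\<in>?E. c e * (\<mu>2 e)\<^sup>2)"
  note positive = period_form_positive_definite[where c = c and ?M1.0 = M1 and ?M2.0 = M2
      and ?\<mu>1.0 = \<mu>1 and ?\<mu>2.0 = \<mu>2, OF c M1 M2 deck z0]
  have s: "0 < s" using positive[of 0 1] by (simp add: s_def)
  \<comment> \<open>the value at \<open>(s, - r)\<close> is \<open>s\<close> times the determinant, which is therefore positive\<close>
  have "(\<Sum>e\<in>?E. c e * (a * \<mu>1 e + b * \<mu>2 e)\<^sup>2) = a\<^sup>2 * p + 2 * a * b * r + b\<^sup>2 * s" for a b
    unfolding p_def r_def s_def
    by (simp add: sum_distrib_left sum.distrib power2_eq_square algebra_simps)
  then have "(\<Sum>e\<in>?E. c e * (s * \<mu>1 e + (- r) * \<mu>2 e)\<^sup>2) = s\<^sup>2 * p + 2 * s * (- r) * r + (- r)\<^sup>2 * s"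
    by blast
  also have "\<dots> = s * (p * s - r\<^sup>2)" by (simp add: power2_eq_square algebra_simps)
  finally have "0 < s * (p * s - r\<^sup>2)" using positive[of s "- r"] s by simp
  then have D: "0 < p * s - r\<^sup>2" using s by (simp add: zero_less_mult_iff)
  \<comment> \<open>the case of equality in the bound for flat tori\<close>
  define \<tau>0 where "\<tau>0 = Complex (- r / s) (sqrt (p * s - r\<^sup>2) / s)"
  have \<tau>0: "0 < Im \<tau>0" using s D by (simp add: \<tau>0_def)
  define h0 where "h0 z = 1 / of_real (sqrt (Im \<tau>0)) * of_real (M1 z) +
    \<tau>0 / of_real (sqrt (Im \<tau>0)) * of_real (M2 z)" for z
  have map0: "straight_line_map \<theta> K g1 g2 \<tau>0 h0"
    by (simp add: straight_line_map_def h0_def M1 M2 distrib_left)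
  have "dirichlet_energy \<theta> K c h0 = 1 / 2 * (\<Sum>e\<in>?E. c e *
      (cmod (1 / of_real (sqrt (Im \<tau>0)) * of_real (\<mu>1 e) + \<tau>0 / of_real (sqrt (Im \<tau>0)) * of_real (\<mu>2 e)))\<^sup>2)"
    unfolding h0_def by (rule dirichlet_energy_of_potentials) (fact M1 M2)+
  also have "\<dots> = 1 / 2 * ((p + 2 * Re \<tau>0 * r + ((Re \<tau>0)\<^sup>2 + (Im \<tau>0)\<^sup>2) * s) / Im \<tau>0)"
    unfolding flat_torus_energy[OF \<tau>0] by (simp only: p_def r_def s_def)
  also have "\<dots> = sqrt (p * s - r\<^sup>2)"
    using lattice_energy_minimum[OF s D] by (simp add: \<tau>0_def)
  finally have energy0: "dirichlet_energy \<theta> K c h0 = sqrt (p * s - r\<^sup>2)" .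
  have bound: "sqrt (p * s - r\<^sup>2) \<le> dirichlet_energy \<theta> K c h"
    if \<tau>: "0 < Im \<tau>" and h: "straight_line_map \<theta> K g1 g2 \<tau> h" for \<tau> h
  proof -
    have "2 * sqrt (p * s - r\<^sup>2) \<le> (p + 2 * Re \<tau> * r + ((Re \<tau>)\<^sup>2 + (Im \<tau>)\<^sup>2) * s) / Im \<tau>"
      using lattice_energy_lower_bound s \<tau> D by simp
    then show ?thesis
      using dirichlet_energy_lower_bound[where c = c and ?M1.0 = M1 and ?M2.0 = M2
            and ?\<mu>1.0 = \<mu>1 and ?\<mu>2.0 = \<mu>2, OF c generators M1 M2 harmonic1 harmonic2 h]
      unfolding flat_torus_energy[OF \<tau>] by (simp add: p_def r_def s_def)
  qed
  have "is_arg_min (\<lambda>(\<tau>, h). dirichlet_energy \<theta> K c h)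
      (\<lambda>(\<tau>, h). 0 < Im \<tau> \<and> straight_line_map \<theta> K g1 g2 \<tau> h) (\<tau>0, h0)"
    using \<tau>0 map0 by (auto simp: is_arg_min_def energy0 dest: bound)
  moreover have "dirichlet_energy \<theta> K c h0 =
      sqrt (det0 v0 (transpose_mat (d_tilde_mat K m1 m2) * weight_mat K c * d_tilde_mat K m1 m2)
            / det0 v0 (transpose_mat (d_mat K) * weight_mat K c * d_mat K))"
    unfolding ratio energy0 p_def r_def s_def ..
  ultimately show ?thesis by blast
qed

end
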